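(* Let $\kappa$ be a regular cardinal and let $\mu$ be a $(\kappa,\kappa^+)$-cardinal which is a stationary subset of $\wp_\kappa(\kappa^+)$. Then there is a $\kappa$-Kurepa tree with exactly $\kappa^+$ many branches of length $\kappa$ which does not contain a $\kappa$-Aronszajn subtree.
   Context: Let $\kappa$ be a regular infinite cardinal. Notation: for sets $A,B$ of ordinals, $A<B$ means $\alpha<\beta$ for all $\alpha\in A,\beta\in B$. If $X,Y$ are sets of ordinals of the same order type, $f_{YX}$ denotes the unique order-preserving bijection from $X$ onto $Y$. For a family $\mu$ and a set $X$, $\mu|X=\{Y\in\mu: Y\subsetneq X\}$. For sets of ordinals $X_1,X_2$ of the same order type with $X_1\cap X_2<X_1\setminus X_2<X_2\setminus X_1$, write $X_1*X_2=X_1\cup X_2$ (otherwise undefined). $\wp_\kappa(\kappa^+)=\{X\subseteq\kappa^+:|X|<\kappa\}$. For a family $\mu$ well-founded under strict inclusion, $rank(X)$ is the rank of $X\in\mu$ in $(\mu,\subsetneq)$. A $(\kappa,\kappa^+)$-cardinal is a family $\mu\subseteq\wp_\kappa(\kappa^+)$ such that: (1) $\mu$ is well-founded with respect to inclusion; (2) $|\mu|X|<\kappa$ for all $X\in\mu$; (3) if $X,Y\in\mu$ have the same rank, then they have the same order type and $\mu|Y=\{f_{YX}[Z]:Z\in\mu|X\}$; (4) for all $X,Y\in\mu$ there is $Z\in\mu$ with $X\cup Y\subseteq Z$; (5) for every $X\in\mu$, either $\mu|X$ is directed, or there are $X_1,X_2\in\mu$ of the same rank with $X=X_1*X_2$ and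 $\mu|X=(\mu|X_1)\cup(\mu|X_2)\cup\{X_1,X_2\}$; (6) $\bigcup\mu=\kappa^+$; (7) every $X\in\mu$ of nonzero rank satisfies $X=\bigcup(\mu|X)$. Stationarity in $\wp_\kappa(\kappa^+)$ is in the usual sense (meeting every club subset of $\wp_\kappa(\kappa^+)$). A $\kappa$-Kurepa tree is a tree of height $\kappa$ all of whose levels have cardinality $<\kappa$ and which has at least $\kappa^+$ branches of length $\kappa$. A $\kappa$-Aronszajn tree is a tree of height $\kappa$ with all levels of cardinality $<\kappa$ and no branch of length $\kappa$. *)

theory Defs
  imports Main
begin

unbundle cardinal_syntax

text \<open>
  As in the library's theory of cardinals, ordinals and cardinals are reflexive well-order
  relations: an infinite cardinal is some \<open>\<kappa> :: 'k rel\<close> with \<^prop>\<open>Cinfinite \<kappa>\<close>, its successor is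
  \<^term>\<open>cardSuc \<kappa>\<close>, the ordinals below \<open>\<kappa>\<close> are the elements of \<^term>\<open>Field \<kappa>\<close>, and \<open>\<alpha>\<close> as an
  ordinal is \<^term>\<open>Restr \<kappa> (underS \<kappa> \<alpha>)\<close>. The order type of a set \<open>X\<close> of ordinals below \<open>\<lambda>\<close> is
  \<^term>\<open>Restr lam X\<close> up to \<^const>\<open>ordIso\<close>. Below, \<open>lam\<close> plays the role of \<open>\<kappa>\<^sup>+\<close>.
\<close>


section \<open>Sets of ordinals\<close>

definition same_otp :: "'o rel \<Rightarrow> 'o set \<Rightarrow> 'o set \<Rightarrow> bool" where
  "same_otp lam X Y \<longleftrightarrow> Restr lam X =o Restr lam Y"

text \<open>The map \<open>f\<^bsub>YX\<^esub>\<close>. It is uniquely determined on \<open>X\<close>; its values outside \<open>X\<close> are irrelevant.\<close>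

definition order_bij :: "'o rel \<Rightarrow> 'o set \<Rightarrow> 'o set \<Rightarrow> 'o \<Rightarrow> 'o" where
  "order_bij lam Y X = (SOME f. iso (Restr lam X) (Restr lam Y) f)"

definition set_less :: "'o rel \<Rightarrow> 'o set \<Rightarrow> 'o set \<Rightarrow> bool" where
  "set_less lam A B \<longleftrightarrow> (\<forall>\<alpha>\<in>A. \<forall>\<beta>\<in>B. \<alpha> \<noteq> \<beta> \<and> (\<alpha>, \<beta>) \<in> lam)"

text \<open>\<open>X = X\<^sub>1 * X\<^sub>2\<close>, including the assertion that the right-hand side is defined.\<close>

definition is_star :: "'o rel \<Rightarrow> 'o set \<Rightarrow> 'o set \<Rightarrow> 'o set \<Rightarrow> bool" where
  "is_star lam X X1 X2 \<longleftrightarrow>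
     same_otp lam X1 X2 \<and>
     set_less lam (X1 \<inter> X2) (X1 - X2) \<and> set_less lam (X1 - X2) (X2 - X1) \<and>
     X = X1 \<union> X2"

definition small_sets :: "'k rel \<Rightarrow> 'o rel \<Rightarrow> 'o set set" where
  "small_sets \<kappa> lam = {X. X \<subseteq> Field lam \<and> |X| <o \<kappa>}"


section \<open>Club and stationary families of small sets\<close>

text \<open>Closure under unions of nonempty \<open>\<subseteq>\<close>-chains of cardinality less than \<open>\<kappa>\<close>.\<close>

definition club_sets :: "'k rel \<Rightarrow> 'o rel \<Rightarrow> 'o set set \<Rightarrow> bool" where
  "club_sets \<kappa> lam C \<longleftrightarrow>
     C \<subseteq> small_sets \<kappa> lam \<and>
     (\<forall>X\<in>small_sets \<kappa> lam. \<exists>Y\<in>C. X \<subseteq> Y) \<and>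
     (\<forall>D. D \<subseteq> C \<and> D \<noteq> {} \<and> chain\<^sub>\<subseteq> D \<and> |D| <o \<kappa> \<longrightarrow> \<Union>D \<in> C)"

definition stationary_sets :: "'k rel \<Rightarrow> 'o rel \<Rightarrow> 'o set set \<Rightarrow> bool" where
  "stationary_sets \<kappa> lam S \<longleftrightarrow>
     S \<subseteq> small_sets \<kappa> lam \<and> (\<forall>C. club_sets \<kappa> lam C \<longrightarrow> S \<inter> C \<noteq> {})"


section \<open>\<open>(\<kappa>, \<kappa>\<^sup>+)\<close>-cardinals\<close>

text \<open>The family \<open>\<mu>|X\<close>.\<close>

definition below :: "'o set set \<Rightarrow> 'o set \<Rightarrow> 'o set set" where
  "below \<mu> X = {Y \<in> \<mu>. Y \<subset> X}"

definition incl_rel :: "'o set set \<Rightarrow> 'o set rel" where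
  "incl_rel \<mu> = {(Y, X). X \<in> \<mu> \<and> Y \<in> below \<mu> X}"

text \<open>
  The rank of \<open>X\<close> in \<open>(\<mu>, \<subset>)\<close> is the least ordinal strictly above the ranks of all elements of
  \<open>\<mu>|X\<close>, given here as an element of \<^term>\<open>Field \<kappa>\<close>. If \<open>\<kappa>\<close> is regular, \<open>(\<mu>, \<subset>)\<close> is
  well-founded and every \<open>\<mu>|X\<close> has fewer than \<open>\<kappa>\<close> elements, then all ranks are below \<open>\<kappa>\<close>
  (lemma \<open>rank_step\<close>), so nothing is lost; the rank is only used under these conditions.
  Note that \<^term>\<open>wo_rel.suc \<kappa> A\<close> is the least strict upper bound of the set \<open>A\<close>.
\<close>

definition rank :: "'k rel \<Rightarrow> 'o set set \<Rightarrow> 'o set \<Rightarrow> 'k" where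
  "rank \<kappa> \<mu> = wfrec (incl_rel \<mu>) (\<lambda>f X. wo_rel.suc \<kappa> (f ` below \<mu> X))"

definition directed :: "'o set set \<Rightarrow> bool" where
  "directed F \<longleftrightarrow> (\<forall>X\<in>F. \<forall>Y\<in>F. \<exists>Z\<in>F. X \<union> Y \<subseteq> Z)"

definition two_cardinal :: "'k rel \<Rightarrow> 'o rel \<Rightarrow> 'o set set \<Rightarrow> bool" where
  "two_cardinal \<kappa> lam \<mu> \<longleftrightarrow>
     \<mu> \<subseteq> small_sets \<kappa> lam \<and>
     wf (incl_rel \<mu>) \<and>
     (\<forall>X\<in>\<mu>. |below \<mu> X| <o \<kappa>) \<and>
     (\<forall>X\<in>\<mu>. \<forall>Y\<in>\<mu>. rank \<kappa> \<mu> X = rank \<kappa> \<mu> Y \<longrightarrow>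
        same_otp lam X Y \<and> below \<mu> Y = {order_bij lam Y X ` Z | Z. Z \<in> below \<mu> X}) \<and>
     directed \<mu> \<and>
     (\<forall>X\<in>\<mu>. directed (below \<mu> X) \<or>
        (\<exists>X1\<in>\<mu>. \<exists>X2\<in>\<mu>. rank \<kappa> \<mu> X1 = rank \<kappa> \<mu> X2 \<and> is_star lam X X1 X2 \<and>
           below \<mu> X = below \<mu> X1 \<union> below \<mu> X2 \<union> {X1, X2})) \<and>
     \<Union>\<mu> = Field lam \<and>
     (\<forall>X\<in>\<mu>. rank \<kappa> \<mu> X \<noteq> wo_rel.minim \<kappa> (Field \<kappa>) \<longrightarrow> X = \<Union>(below \<mu> X))"


section \<open>Trees\<close>

text \<open>
  A tree is given by its reflexive order relation; its nodes are the elements of the field.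
  The subtree on a set \<open>S\<close> of nodes is \<^term>\<open>Restr T S\<close>.
\<close>

definition is_tree :: "'t rel \<Rightarrow> bool" where
  "is_tree T \<longleftrightarrow>
     partial_order_on (Field T) T \<and>
     (\<forall>t\<in>Field T. Well_order (Restr T (underS T t)))"

definition tree_level :: "'k rel \<Rightarrow> 't rel \<Rightarrow> 'k \<Rightarrow> 't set" where
  "tree_level \<kappa> T \<alpha> = {t \<in> Field T. Restr T (underS T t) =o Restr \<kappa> (underS \<kappa> \<alpha>)}"

text \<open>Height exactly \<open>\<kappa>\<close>: every node has height below \<open>\<kappa>\<close> and no level below \<open>\<kappa>\<close> is empty.\<close>

definition has_height :: "'k rel \<Rightarrow> 't rel \<Rightarrow> bool" where
  "has_height \<kappa> T \<longleftrightarrow>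
     (\<forall>t\<in>Field T. Restr T (underS T t) <o \<kappa>) \<and>
     (\<forall>\<alpha>\<in>Field \<kappa>. tree_level \<kappa> T \<alpha> \<noteq> {})"

definition small_levels :: "'k rel \<Rightarrow> 't rel \<Rightarrow> bool" where
  "small_levels \<kappa> T \<longleftrightarrow> (\<forall>\<alpha>\<in>Field \<kappa>. |tree_level \<kappa> T \<alpha>| <o \<kappa>)"

text \<open>The branches (that is, maximal chains) of length \<open>\<kappa>\<close>.\<close>

definition branches :: "'k rel \<Rightarrow> 't rel \<Rightarrow> 't set set" where
  "branches \<kappa> T =
     {b \<in> Chains T. (\<forall>c\<in>Chains T. b \<subseteq> c \<longrightarrow> c = b) \<and> Restr T b =o \<kappa>}"

definition kurepa_tree :: "'k rel \<Rightarrow> 't rel \<Rightarrow> bool" where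
  "kurepa_tree \<kappa> T \<longleftrightarrow>
     is_tree T \<and> has_height \<kappa> T \<and> small_levels \<kappa> T \<and> cardSuc \<kappa> \<le>o |branches \<kappa> T|"

definition aronszajn_tree :: "'k rel \<Rightarrow> 't rel \<Rightarrow> bool" where
  "aronszajn_tree \<kappa> T \<longleftrightarrow>
     is_tree T \<and> has_height \<kappa> T \<and> small_levels \<kappa> T \<and> branches \<kappa> T = {}"


section \<open>The rank is well defined\<close>

lemma rank_step:
  assumes \<kappa>: "Cinfinite \<kappa>" "regularCard \<kappa>"
    and wf: "wf (incl_rel \<mu>)" and small: "\<forall>X\<in>\<mu>. |below \<mu> X| <o \<kappa>" and "X \<in> \<mu>"
  shows "rank \<kappa> \<mu> X \<in> Field \<kappa>"
    and "rank \<kappa> \<mu> X = wo_rel.suc \<kappa> (rank \<kappa> \<mu> ` below \<mu> X)"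
    and "AboveS \<kappa> (rank \<kappa> \<mu> ` below \<mu> X) \<noteq> {}"
proof -
  have wo: "wo_rel \<kappa>" and inf: "infinite (Field \<kappa>)"
    using \<kappa>(1) by (auto simp: wo_rel_def cinfinite_def card_order_on_well_order_on)
  have eq: "rank \<kappa> \<mu> X = wo_rel.suc \<kappa> (rank \<kappa> \<mu> ` below \<mu> X)" if "X \<in> \<mu>" for X
  proof -
    have "cut (rank \<kappa> \<mu>) (incl_rel \<mu>) X ` below \<mu> X = rank \<kappa> \<mu> ` below \<mu> X"
      using that by (auto simp: cut_def incl_rel_def intro!: image_cong)
    then show ?thesis
      unfolding rank_def by (subst wfrec[OF wf]) simp
  qed
  have "rank \<kappa> \<mu> X \<in> Field \<kappa> \<and> AboveS \<kappa> (rank \<kappa> \<mu> ` below \<mu> X) \<noteq> {}" if "X \<in> \<mu>" for X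
    using wf that
  proof (induction X rule: wf_induct_rule)
    case (less X)
    let ?K = "rank \<kappa> \<mu> ` below \<mu> X"
    have sub: "?K \<subseteq> Field \<kappa>"
      using less by (auto simp: incl_rel_def below_def)
    have "|?K| <o \<kappa>"
      using ordLeq_ordLess_trans[OF card_of_image] small less.prems by blast
    then have "\<not> cofinal ?K \<kappa>"
      using \<kappa>(2) sub not_ordLess_ordIso unfolding regularCard_def by blast
    then obtain a where a: "a \<in> Field \<kappa>" "\<And>b. b \<in> ?K \<Longrightarrow> a = b \<or> (a, b) \<notin> \<kappa>"
      unfolding cofinal_def by blast
    obtain c where c: "c \<in> Field \<kappa>" "a \<noteq> c" "(a, c) \<in> \<kappa>"
      using infinite_Card_order_limit[OF conjunct2[OF \<kappa>(1)] inf a(1)] by blast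
    have "b \<noteq> c \<and> (b, c) \<in> \<kappa>" if "b \<in> ?K" for b
    proof -
      have "(b, a) \<in> \<kappa>"
        using a(1) a(2)[OF that] that sub wo_rel.TOTALS[OF wo] by blast
      then show ?thesis
        using c transD[OF wo_rel.TRANS[OF wo], of b a c] antisymD[OF wo_rel.ANTISYM[OF wo], of a c]
        by auto
    qed
    then have ne: "AboveS \<kappa> ?K \<noteq> {}"
      using c(1) unfolding AboveS_def by blast
    then show ?case
      using eq[OF less.prems] wo_rel.suc_inField[OF wo sub] by simp
  qed
  from this[OF \<open>X \<in> \<mu>\<close>] show "rank \<kappa> \<mu> X \<in> Field \<kappa>"
    and "AboveS \<kappa> (rank \<kappa> \<mu> ` below \<mu> X) \<noteq> {}"
    by (rule conjunct1, rule conjunct2)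
  show "rank \<kappa> \<mu> X = wo_rel.suc \<kappa> (rank \<kappa> \<mu> ` below \<mu> X)"
    using \<open>X \<in> \<mu>\<close> by (rule eq)
qed

end

theory Submission
  imports Defs
begin

text \<open>
  If \<open>X, Y \<in> \<mu>\<close> have the same rank and share a point \<open>\<xi>\<close>, then \<open>X \<inter> \<xi> = Y \<inter> \<xi>\<close>. Hence the
  position of \<open>\<xi>\<close> at level \<open>\<alpha>\<close>, that is the order type of \<open>X \<inter> \<xi>\<close> for any \<open>X \<in> \<mu>\<close> of rank \<open>\<alpha>\<close>
  that contains \<open>\<xi>\<close>, is well defined. The positions at level \<open>\<alpha>\<close> are the nodes of level \<open>\<alpha>\<close> of a tree,
  and every \<open>\<xi> < \<kappa>\<^sup>+\<close> determines a branch of length \<open>\<kappa>\<close>. If \<open>X \<in> \<mu>\<close> has rank \<open>\<delta>\<close>, then each node of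
  level \<open>\<delta>\<close> lies on the branch of some \<open>\<xi> \<in> X\<close>. Stationarity provides such an \<open>X\<close> closed under
  prescribed functions: a further branch of length \<open>\<kappa>\<close>, or a subtree of height \<open>\<kappa>\<close> which meets every
  branch in a bounded set, leaves all these branches below level \<open>\<delta>\<close>, which is
  contradictory at level \<open>\<delta>\<close>.
\<close>


section \<open>Restrictions of well-orders\<close>

lemma (in wo_rel) underS_trans:
  "a \<in> underS b \<Longrightarrow> (b, c) \<in> r \<Longrightarrow> a \<in> underS c"
  using TRANS ANTISYM unfolding Order_Relation.underS_def trans_def antisym_def by blast

lemma (in wo_rel) underS_trans':
  "(a, b) \<in> r \<Longrightarrow> b \<in> underS c \<Longrightarrow> a \<in> underS c"
  using TRANS ANTISYM unfolding Order_Relation.underS_def trans_def antisym_def by blast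

lemma (in wo_rel) underS_mono: "b \<in> underS c \<Longrightarrow> underS b \<subseteq> underS c"
  using underS_trans unfolding Order_Relation.underS_def by blast

lemma (in wo_rel) not_underS_iff:
  "a \<in> Field r \<Longrightarrow> b \<in> Field r \<Longrightarrow> a \<notin> underS b \<longleftrightarrow> (b, a) \<in> r"
  using TOTALS ANTISYM REFL unfolding Order_Relation.underS_def antisym_def refl_on_def by blast

lemma (in wo_rel) underS_induct [consumes 1, case_names less]:
  assumes "a \<in> Field r" and "\<And>a. a \<in> Field r \<Longrightarrow> (\<And>b. b \<in> underS a \<Longrightarrow> P b) \<Longrightarrow> P a"
  shows "P a"
proof -
  have "a \<in> Field r \<longrightarrow> P a"
  proof (rule well_order_induct, intro impI)
    fix x assume IH: "\<forall>y. y \<noteq> x \<and> (y, x) \<in> r \<longrightarrow> y \<in> Field r \<longrightarrow> P y" and x: "x \<in> Field r"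
    show "P x"
    proof (rule assms(2)[OF x])
      fix b assume "b \<in> underS x"
      then show "P b"
        using IH by (auto simp: Order_Relation.underS_def intro: FieldI1)
    qed
  qed
  then show ?thesis using assms(1) by blast
qed

lemma iso_Restr_iff:
  assumes "Refl r" "Refl r'" "X \<subseteq> Field r" "Y \<subseteq> Field r'"
  shows "iso (Restr r X) (Restr r' Y) f \<longleftrightarrow>
    bij_betw f X Y \<and> (\<forall>x\<in>X. \<forall>y\<in>X. (x, y) \<in> r \<longleftrightarrow> (f x, f y) \<in> r')"
  using assms by (auto simp: iso_iff2 Refl_Field_Restr2 bij_betw_def)

lemma ordIso_Restr_iff:
  assumes "Well_order r" "Well_order r'"
  shows "Restr r X =o Restr r' Y \<longleftrightarrow> (\<exists>f. iso (Restr r X) (Restr r' Y) f)"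
  using assms by (auto simp: ordIso_def Well_order_Restr)

lemma underS_Restr: "a \<in> X \<Longrightarrow> underS (Restr r X) a = X \<inter> underS r a"
  by (auto simp: underS_def)

lemma iso_Restr_subset:
  assumes "Refl r" "Refl r'" "X \<subseteq> Field r" "Y \<subseteq> Field r'"
    and f: "iso (Restr r X) (Restr r' Y) f" and "Z \<subseteq> X"
  shows "iso (Restr r Z) (Restr r' (f ` Z)) f"
proof -
  have "f ` Z \<subseteq> Y"
    using assms by (auto simp: iso_Restr_iff bij_betw_def)
  then show ?thesis
    using f \<open>Z \<subseteq> X\<close> assms(3,4) unfolding iso_Restr_iff[OF assms(1-4)]
    by (subst iso_Restr_iff[OF assms(1,2)]) (auto simp: bij_betw_def inj_on_subset subset_iff)
qed

lemma iso_Restr_image_underS: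
  assumes "Refl r" "Refl r'" "X \<subseteq> Field r" "Y \<subseteq> Field r'"
    and f: "iso (Restr r X) (Restr r' Y) f" and "Z \<subseteq> X" "a \<in> X"
  shows "f ` (Z \<inter> underS r a) = f ` Z \<inter> underS r' (f a)"
  using assms unfolding iso_Restr_iff[OF assms(1-4)] bij_betw_def inj_on_def underS_def by blast

lemma iso_Restr_underS:
  assumes "Well_order r" "Well_order r'" "X \<subseteq> Field r" "Y \<subseteq> Field r'"
    and f: "iso (Restr r X) (Restr r' Y) f" and "Z \<subseteq> X" "a \<in> X"
  shows "Restr r (Z \<inter> underS r a) =o Restr r' (f ` Z \<inter> underS r' (f a))"
proof -
  have "Refl r" "Refl r'"
    using assms(1,2) by (auto simp: wo_rel_def intro: wo_rel.REFL)
  then show ?thesis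
    using iso_Restr_subset[OF _ _ assms(3-5), of "Z \<inter> underS r a"]
      iso_Restr_image_underS[OF _ _ assms(3-7)] assms ordIso_Restr_iff by fastforce
qed

context wo_rel
begin

text \<open>Of two distinct points of \<open>X\<close>, the segment of \<open>X\<close> at one is a
  proper initial segment of the segment at the other, and no well-order is isomorphic to a proper
  initial segment of itself.\<close>

lemma Restr_underS_inj:
  assumes "X \<subseteq> Field r" "a \<in> X" "b \<in> X"
    and eq: "Restr r (X \<inter> underS a) =o Restr r (X \<inter> underS b)"
  shows "a = b"
proof -
  have less: "Restr r (X \<inter> underS c) <o Restr r (X \<inter> underS d)"
    if "c \<in> underS d" "c \<in> X" for c d
  proof -
    let ?s = "Restr r (X \<inter> underS d)"
    have *: "X \<inter> underS c = X \<inter> underS d \<inter> underS c"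
      using that underS_trans unfolding Order_Relation.underS_def by blast
    then have "Restr r (X \<inter> underS c) = Restr ?s (Order_Relation.underS ?s c)"
      using underS_Restr[of c "X \<inter> underS d" r] that by auto
    moreover have "Field ?s \<noteq> {}"
      using that assms(1) REFL by (subst Refl_Field_Restr2) auto
    ultimately show ?thesis
      using underS_Restr_ordLess[of ?s c] Well_order_Restr[OF WELL] by simp
  qed
  have "a = b \<or> a \<in> underS b \<or> b \<in> underS a"
    using assms TOTALS unfolding Order_Relation.underS_def by blast
  then show ?thesis
    using less assms eq not_ordLess_ordIso ordIso_symmetric by blast
qed

text \<open>Otherwise an isomorphism \<open>f\<close> maps \<open>B\<close> onto the part of
  \<open>A\<close> below some \<open>a\<close>. A point \<open>x\<close> moved strictly down starts
  an infinite descent \<open>x\<close>, \<open>f x\<close>, \<open>f (f x)\<close> and so on, but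
  \<open>a\<close> is such a point.\<close>

lemma Restr_mono_ordLeq:
  assumes "A \<subseteq> B" "B \<subseteq> Field r"
  shows "Restr r A \<le>o Restr r B"
proof (rule ccontr)
  have A: "A \<subseteq> Field r"
    using assms by blast
  have wo: "Well_order (Restr r A)" "Well_order (Restr r B)"
    using Well_order_Restr[OF WELL] by auto
  assume "\<not> ?thesis"
  then have "Restr r B <o Restr r A"
    using wo by (simp only: not_ordLeq_iff_ordLess)
  then obtain a where a: "a \<in> A"
    and "Restr r B =o Restr (Restr r A) (Order_Relation.underS (Restr r A) a)"
    unfolding ordLess_iff_ordIso_Restr[OF wo] Refl_Field_Restr2[OF REFL A] by blast
  moreover have "Restr (Restr r A) (Order_Relation.underS (Restr r A) a) = Restr r (A \<inter> underS a)"
    unfolding underS_Restr[OF a] by blast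
  ultimately obtain f where f: "iso (Restr r B) (Restr r (A \<inter> underS a)) f"
    using ordIso_Restr_iff[OF WELL WELL] by auto
  have "A \<inter> underS a \<subseteq> Field r"
    using A by blast
  note * = f[unfolded iso_Restr_iff[OF REFL REFL assms(2) this]]
  have "x \<in> B \<longrightarrow> f x \<notin> underS x" if "x \<in> Field r" for x
    using that
  proof (induction rule: underS_induct)
    case (less x)
    show ?case
    proof (intro impI notI)
      assume x: "x \<in> B" "f x \<in> underS x"
      then have "f x \<in> B"
        using * assms by (auto simp: bij_betw_def)
      moreover have "f (f x) \<in> underS (f x)"
        using * x \<open>f x \<in> B\<close> by (auto simp: Order_Relation.underS_def bij_betw_def inj_on_def)
      ultimately show False
        using less.IH x by blast
    qed
  qed
  moreover have "a \<in> B" "f a \<in> underS a"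
    using a assms * by (auto simp: bij_betw_def)
  ultimately show False
    using assms by blast
qed

text \<open>\<open>D\<close> is a common initial segment of \<open>X\<close> and \<open>Y\<close>;
  induction along \<open>D\<close>. If \<open>f d\<close> lay below \<open>d\<close>, it would be a
  fixed point in \<open>D\<close>, against injectivity; if \<open>d\<close> lay below
  \<open>f d\<close>, the preimage of \<open>d\<close> would be a smaller point of \<open>D\<close>,
  hence fixed, which is again impossible.\<close>

lemma iso_Restr_fixes_common_segment:
  assumes "X \<subseteq> Field r" "Y \<subseteq> Field r" and f: "iso (Restr r X) (Restr r Y) f"
    and D: "D \<subseteq> X \<inter> Y" "\<And>x d. d \<in> D \<Longrightarrow> x \<in> X \<union> Y \<Longrightarrow> x \<in> underS d \<Longrightarrow> x \<in> D"
    and "d \<in> D"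
  shows "f d = d"
proof -
  note * = f[unfolded iso_Restr_iff[OF REFL REFL assms(1,2)]]
  have lt: "x \<in> underS y \<longleftrightarrow> f x \<in> underS (f y)" if "x \<in> X" "y \<in> X" for x y
    using * that by (auto simp: Order_Relation.underS_def bij_betw_def inj_on_def)
  have inj: "inj_on f X" and im: "f ` X = Y"
    using * by (auto simp: bij_betw_def)
  have "d \<in> Field r"
    using assms by blast
  then have "d \<in> D \<longrightarrow> f d = d"
  proof (induction rule: underS_induct)
    case (less d)
    show ?case
    proof
      assume d: "d \<in> D"
      then have dX: "d \<in> X" "d \<in> Y" using D by auto
      have fd: "f d \<in> Y" using dX im by blast
      have "f d \<in> underS d \<or> d \<in> underS (f d) \<or> f d = d"
        using not_underS_iff[of "f d" d] not_underS_iff[of d "f d"] dX fd assms(1,2) ANTISYM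
        unfolding antisym_def by blast
      then show "f d = d"
      proof (elim disjE)
        assume "f d \<in> underS d"
        then have "f d \<in> D" "f (f d) = f d"
          using D(2)[OF d, of "f d"] fd less.IH[of "f d"] by auto
        then show ?thesis
          using inj dX D by (auto dest: inj_onD)
      next
        assume l: "d \<in> underS (f d)"
        obtain z where z: "z \<in> X" "d = f z"
          using dX im by blast
        then have zd: "z \<in> underS d"
          using lt[OF z(1) dX(1)] l by simp
        then have "f z = z"
          using D(2)[OF d, of z] less.IH[OF zd] z by blast
        then show ?thesis
          using z by simp
      qed
    qed
  qed
  then show ?thesis using \<open>d \<in> D\<close> by blast
qed

end


section \<open>Regular cardinals\<close>

locale regular_cardinal =
  fixes \<kappa> :: "'k rel"
  assumes Cinf: "Cinfinite \<kappa>" and reg: "regularCard \<kappa>"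
begin

lemma card_order: "Card_order \<kappa>"
  using Cinf by blast

lemma infinite_Field: "infinite (Field \<kappa>)"
  using Cinf by (simp add: cinfinite_def)

lemma well_order: "Well_order \<kappa>"
  using card_order card_order_on_well_order_on by blast

sublocale wo: wo_rel \<kappa>
  using well_order by (simp add: wo_rel_def)

lemma underS_subset: "underS \<kappa> a \<subseteq> Field \<kappa>"
  by (auto simp: underS_def Field_def)

lemma underS_ordIso_iff:
  assumes "\<alpha> \<in> Field \<kappa>" "\<beta> \<in> Field \<kappa>"
  shows "Restr \<kappa> (underS \<kappa> \<alpha>) =o Restr \<kappa> (underS \<kappa> \<beta>) \<longleftrightarrow> \<alpha> = \<beta>"
proof -
  have "Field \<kappa> \<inter> underS \<kappa> \<gamma> = underS \<kappa> \<gamma>" for \<gamma>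
    using underS_subset by fastforce
  then show ?thesis
    using wo.Restr_underS_inj[of "Field \<kappa>" \<alpha> \<beta>] assms
      ordIso_reflexive[OF Well_order_Restr[OF well_order]] by auto
qed

lemma small_UNION:
  "|I| <o \<kappa> \<Longrightarrow> (\<And>i. i \<in> I \<Longrightarrow> |A i| <o \<kappa>) \<Longrightarrow> |\<Union>i\<in>I. A i| <o \<kappa>"
  using stable_UNION regularCard_stable[OF card_order infinite_Field reg] by blast

lemma small_subset: "A \<subseteq> B \<Longrightarrow> |B| <o \<kappa> \<Longrightarrow> |A| <o \<kappa>"
  using card_of_mono1 ordLeq_ordLess_trans by blast

lemma small_image: "|A| <o \<kappa> \<Longrightarrow> |f ` A| <o \<kappa>"
  using card_of_image ordLeq_ordLess_trans by blast

lemma small_Un: "|A| <o \<kappa> \<Longrightarrow> |B| <o \<kappa> \<Longrightarrow> |A \<union> B| <o \<kappa>"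
  using card_of_Un_ordLess_infinite_Field[OF infinite_Field card_order] by blast

lemma small_finite: "finite A \<Longrightarrow> |A| <o \<kappa>"
  using finite_ordLess_infinite[OF card_of_Well_order well_order] infinite_Field
  by (simp add: Field_card_of)

lemma small_underS: "a \<in> Field \<kappa> \<Longrightarrow> |underS \<kappa> a| <o \<kappa>"
  using card_of_underS[OF card_order] by blast

lemma small_under: "a \<in> Field \<kappa> \<Longrightarrow> |under \<kappa> a| <o \<kappa>"
  using small_Un[OF small_underS small_finite[of "{a}"]] Refl_under_underS[OF wo.REFL] by fastforce

lemma small_bounded:
  assumes "A \<subseteq> Field \<kappa>" "|A| <o \<kappa>"
  obtains b where "b \<in> Field \<kappa>" "\<And>a. a \<in> A \<Longrightarrow> a \<in> underS \<kappa> b"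
proof -
  have "\<not> cofinal A \<kappa>"
    using assms reg not_ordLess_ordIso unfolding regularCard_def by blast
  then obtain c where c: "c \<in> Field \<kappa>" "\<And>b. b \<in> A \<Longrightarrow> c = b \<or> (c, b) \<notin> \<kappa>"
    unfolding cofinal_def by blast
  \<comment> \<open>\<open>c\<close> bounds \<open>A\<close> only weakly; an infinite cardinal has
    no last element, which yields a strict bound.\<close>
  obtain b where b: "b \<in> Field \<kappa>" "c \<noteq> b" "(c, b) \<in> \<kappa>"
    using infinite_Card_order_limit[OF card_order infinite_Field c(1)] by blast
  have "a \<in> underS \<kappa> b" if "a \<in> A" for a
    using c(2)[OF that] c(1) b that assms(1) wo.TOTALS wo.underS_trans'[of a c b]
    unfolding underS_def by blast
  then show thesis using b(1) that by blast
qed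

text \<open>By regularity an unbounded set has at least \<kappa> elements, and a cardinal is the
  least order type of its size; the other inequality is monotonicity of order types.\<close>

lemma unbounded_ordIso:
  assumes A: "A \<subseteq> Field \<kappa>" and unb: "\<And>b. b \<in> Field \<kappa> \<Longrightarrow> \<exists>a\<in>A. a \<notin> underS \<kappa> b"
  shows "Restr \<kappa> A =o \<kappa>"
proof -
  have "\<not> |A| <o \<kappa>"
    using small_bounded[OF A] unb by metis
  then have "\<kappa> \<le>o |A|"
    by (metis not_ordLess_iff_ordLeq card_of_Well_order well_order)
  moreover have "|A| \<le>o Restr \<kappa> A"
    using card_of_least[OF well_order_on_Restr[OF well_order A]] .
  ultimately have "\<kappa> \<le>o Restr \<kappa> A"
    using ordLeq_transitive by blast
  moreover have "Restr \<kappa> A \<le>o \<kappa>"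
    using wo.Restr_mono_ordLeq[OF A] by (simp add: Restr_Field)
  ultimately show ?thesis
    by (simp add: ordIso_iff_ordLeq)
qed

end


section \<open>Coherent systems of branches\<close>

text \<open>The interface between the family \<mu> and the tree. \<open>p \<alpha> \<xi>\<close> is
  meant as the node of level \<alpha> on the branch with index \<xi>. The axiom
  \<open>p_reflect\<close> is the form in which stationarity enters: every node of level \<delta>
  lies on a branch whose prescribed value \<open>g \<eta>\<close> is already below \<delta>.\<close>

locale branch_system = regular_cardinal \<kappa> for \<kappa> :: "'k rel" +
  fixes L :: "'i set" and p :: "'k \<Rightarrow> 'i \<Rightarrow> 't"
  assumes L_nonempty: "L \<noteq> {}"
    and p_level: "\<lbrakk>\<alpha> \<in> Field \<kappa>; \<beta> \<in> Field \<kappa>; \<xi> \<in> L; \<eta> \<in> L; p \<alpha> \<xi> = p \<beta> \<eta>\<rbrakk> \<Longrightarrow> \<alpha> = \<beta>"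
    and p_below: "\<lbrakk>(\<gamma>, \<alpha>) \<in> \<kappa>; \<xi> \<in> L; \<eta> \<in> L; p \<alpha> \<xi> = p \<alpha> \<eta>\<rbrakk> \<Longrightarrow> p \<gamma> \<xi> = p \<gamma> \<eta>"
    and p_small: "\<alpha> \<in> Field \<kappa> \<Longrightarrow> |p \<alpha> ` L| <o \<kappa>"
    and p_separated: "\<lbrakk>\<xi> \<in> L; \<eta> \<in> L; \<xi> \<noteq> \<eta>\<rbrakk> \<Longrightarrow> \<exists>\<alpha>\<in>Field \<kappa>. p \<alpha> \<xi> \<noteq> p \<alpha> \<eta>"
    and p_reflect: "\<lbrakk>\<And>\<xi>. \<xi> \<in> L \<Longrightarrow> g \<xi> \<in> Field \<kappa>; \<And>\<alpha>. \<alpha> \<in> Field \<kappa> \<Longrightarrow> h \<alpha> \<in> Field \<kappa>\<rbrakk> \<Longrightarrow>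
      \<exists>\<delta>\<in>Field \<kappa>. (\<forall>\<alpha>\<in>underS \<kappa> \<delta>. h \<alpha> \<in> underS \<kappa> \<delta>) \<and>
        (\<forall>\<xi>\<in>L. \<exists>\<eta>\<in>L. p \<delta> \<xi> = p \<delta> \<eta> \<and> g \<eta> \<in> underS \<kappa> \<delta>)"
begin

section \<open>The tree order\<close>

definition tree :: "'t rel" where
  "tree = {(p \<alpha> \<xi>, p \<beta> \<xi>) | \<alpha> \<beta> \<xi>. (\<alpha>, \<beta>) \<in> \<kappa> \<and> \<xi> \<in> L}"

text \<open>A node has many names \<open>p \<alpha> \<xi>\<close>, but its level is unique by
  \<open>p_level\<close>, and by \<open>p_below\<close> agreement of two indices at \<beta> descends
  to \<alpha>. So the order can be read off from arbitrary names.\<close>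

lemma tree_iff:
  assumes "\<alpha> \<in> Field \<kappa>" "\<beta> \<in> Field \<kappa>" "\<xi> \<in> L" "\<eta> \<in> L"
  shows "(p \<alpha> \<xi>, p \<beta> \<eta>) \<in> tree \<longleftrightarrow> (\<alpha>, \<beta>) \<in> \<kappa> \<and> p \<alpha> \<xi> = p \<alpha> \<eta>"
proof
  assume "(p \<alpha> \<xi>, p \<beta> \<eta>) \<in> tree"
  then obtain \<alpha>' \<beta>' \<zeta> where *: "p \<alpha> \<xi> = p \<alpha>' \<zeta>" "p \<beta> \<eta> = p \<beta>' \<zeta>" "(\<alpha>', \<beta>') \<in> \<kappa>" "\<zeta> \<in> L"
    unfolding tree_def by blast
  then have "\<alpha>' = \<alpha>" "\<beta>' = \<beta>"
    using p_level[of \<alpha> \<alpha>' \<xi> \<zeta>] p_level[of \<beta> \<beta>' \<eta> \<zeta>] assms FieldI1[of \<alpha>' \<beta>'] FieldI2[of \<alpha>' \<beta>'] by auto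
  then show "(\<alpha>, \<beta>) \<in> \<kappa> \<and> p \<alpha> \<xi> = p \<alpha> \<eta>"
    using * p_below[of \<alpha> \<beta> \<eta> \<zeta>] assms by auto
next
  assume "(\<alpha>, \<beta>) \<in> \<kappa> \<and> p \<alpha> \<xi> = p \<alpha> \<eta>"
  then show "(p \<alpha> \<xi>, p \<beta> \<eta>) \<in> tree"
    using assms unfolding tree_def by auto
qed

lemma Field_tree: "Field tree = {p \<alpha> \<xi> | \<alpha> \<xi>. \<alpha> \<in> Field \<kappa> \<and> \<xi> \<in> L}"
proof -
  have "(\<alpha>, \<alpha>) \<in> \<kappa>" if "\<alpha> \<in> Field \<kappa>" for \<alpha>
    using wo.REFL that by (auto simp: refl_on_def)
  then show ?thesis
    unfolding tree_def Field_def by blast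
qed

lemma nodeE:
  assumes "t \<in> Field tree"
  obtains \<alpha> \<xi> where "t = p \<alpha> \<xi>" "\<alpha> \<in> Field \<kappa>" "\<xi> \<in> L"
  using assms Field_tree by blast

lemma node_in_Field: "\<alpha> \<in> Field \<kappa> \<Longrightarrow> \<xi> \<in> L \<Longrightarrow> p \<alpha> \<xi> \<in> Field tree"
  using Field_tree by blast

lemma tree_refl: "Refl tree"
  unfolding refl_on_def
  by (metis nodeE tree_iff wo.REFL refl_onD)

lemma tree_partial_order: "partial_order_on (Field tree) tree"
  unfolding partial_order_on_def preorder_on_def
proof (intro conjI)
  show "refl_on (Field tree) tree" by (rule tree_refl)
  show "tree \<subseteq> Field tree \<times> Field tree"
    by (auto simp: Field_def)
  show "trans tree"
  proof (rule transI)
    fix s t u assume *: "(s, t) \<in> tree" "(t, u) \<in> tree"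
    then have "s \<in> Field tree" "t \<in> Field tree" "u \<in> Field tree"
      by (auto simp: Field_def)
    then obtain \<alpha> \<xi> \<beta> \<eta> \<gamma> \<zeta> where "s = p \<alpha> \<xi>" "\<alpha> \<in> Field \<kappa>" "\<xi> \<in> L"
      and "t = p \<beta> \<eta>" "\<beta> \<in> Field \<kappa>" "\<eta> \<in> L" and "u = p \<gamma> \<zeta>" "\<gamma> \<in> Field \<kappa>" "\<zeta> \<in> L"
      by (metis nodeE)
    then show "(s, u) \<in> tree"
      using * p_below[of \<alpha> \<beta> \<eta> \<zeta>] transD[OF wo.TRANS, of \<alpha> \<beta> \<gamma>] by (auto simp: tree_iff)
  qed
  show "antisym tree"
  proof (rule antisymI)
    fix s t assume *: "(s, t) \<in> tree" "(t, s) \<in> tree"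
    then have "s \<in> Field tree" "t \<in> Field tree"
      by (auto simp: Field_def)
    then obtain \<alpha> \<xi> \<beta> \<eta> where "s = p \<alpha> \<xi>" "\<alpha> \<in> Field \<kappa>" "\<xi> \<in> L"
      and "t = p \<beta> \<eta>" "\<beta> \<in> Field \<kappa>" "\<eta> \<in> L"
      by (metis nodeE)
    then show "s = t"
      using * antisymD[OF wo.ANTISYM, of \<alpha> \<beta>] by (auto simp: tree_iff)
  qed
qed

lemma underS_tree:
  assumes "\<alpha> \<in> Field \<kappa>" "\<xi> \<in> L"
  shows "underS tree (p \<alpha> \<xi>) = (\<lambda>\<gamma>. p \<gamma> \<xi>) ` underS \<kappa> \<alpha>"
proof (intro equalityI subsetI)
  fix t assume "t \<in> underS tree (p \<alpha> \<xi>)"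
  then have t: "(t, p \<alpha> \<xi>) \<in> tree" "t \<noteq> p \<alpha> \<xi>"
    by (auto simp: underS_def)
  then obtain \<beta> \<eta> where "t = p \<beta> \<eta>" "\<beta> \<in> Field \<kappa>" "\<eta> \<in> L"
    by (metis nodeE FieldI1)
  then show "t \<in> (\<lambda>\<gamma>. p \<gamma> \<xi>) ` underS \<kappa> \<alpha>"
    using t assms by (auto simp: tree_iff underS_def)
next
  fix t assume "t \<in> (\<lambda>\<gamma>. p \<gamma> \<xi>) ` underS \<kappa> \<alpha>"
  then obtain \<gamma> where "t = p \<gamma> \<xi>" "(\<gamma>, \<alpha>) \<in> \<kappa>" "\<gamma> \<noteq> \<alpha>"
    by (auto simp: underS_def)
  then show "t \<in> underS tree (p \<alpha> \<xi>)"
    using assms p_level[of \<gamma> \<alpha> \<xi> \<xi>] FieldI1[of \<gamma> \<alpha> \<kappa>] by (auto simp: tree_iff underS_def)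
qed

section \<open>Order types along a branch and heights in subtrees\<close>

lemma branch_segment_ordIso:
  assumes A: "A \<subseteq> Field \<kappa>" and \<xi>: "\<xi> \<in> L"
  shows "Restr \<kappa> A =o Restr tree ((\<lambda>\<gamma>. p \<gamma> \<xi>) ` A)"
proof -
  have "Restr tree ((\<lambda>\<gamma>. p \<gamma> \<xi>) ` A) = dir_image (Restr \<kappa> A) (\<lambda>\<gamma>. p \<gamma> \<xi>)"
    using A \<xi> by (auto simp: dir_image_def tree_iff subset_iff; metis)
  moreover have "inj_on (\<lambda>\<gamma>. p \<gamma> \<xi>) (Field (Restr \<kappa> A))"
    using A \<xi> p_level by (auto simp: Refl_Field_Restr2 wo.REFL inj_on_def subset_iff)
  ultimately show ?thesis
    using dir_image_ordIso[OF Well_order_Restr[OF well_order]] by metis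
qed

text \<open>A set of levels rather than of nodes, so that heights in a subtree are computed as order
  types of subsets of \<kappa>.\<close>

definition nodes_on :: "'t set \<Rightarrow> 'i \<Rightarrow> 'k set" where
  "nodes_on S \<xi> = {\<gamma> \<in> Field \<kappa>. p \<gamma> \<xi> \<in> S}"

lemma subtree_Field: "S \<subseteq> Field tree \<Longrightarrow> Field (Restr tree S) = S"
  by (rule Refl_Field_Restr2[OF tree_refl])

text \<open>All predecessors of a node lie on any branch through it, and along a branch levels
  correspond to nodes in order. The height in the subtree may be smaller than the level \<beta> in
  the whole tree.\<close>

lemma subtree_height:
  assumes "S \<subseteq> Field tree" "p \<beta> \<xi> \<in> S" "\<beta> \<in> Field \<kappa>" "\<xi> \<in> L"
  shows "Restr \<kappa> (nodes_on S \<xi> \<inter> underS \<kappa> \<beta>)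
    =o Restr (Restr tree S) (underS (Restr tree S) (p \<beta> \<xi>))"
proof -
  have "underS (Restr tree S) (p \<beta> \<xi>) = S \<inter> (\<lambda>\<gamma>. p \<gamma> \<xi>) ` underS \<kappa> \<beta>"
    using underS_Restr[OF assms(2)] underS_tree assms by metis
  also have "\<dots> = (\<lambda>\<gamma>. p \<gamma> \<xi>) ` (nodes_on S \<xi> \<inter> underS \<kappa> \<beta>)"
    using underS_subset by (auto simp: nodes_on_def)
  finally have eq: "underS (Restr tree S) (p \<beta> \<xi>) = (\<lambda>\<gamma>. p \<gamma> \<xi>) ` (nodes_on S \<xi> \<inter> underS \<kappa> \<beta>)" .
  have "(\<lambda>\<gamma>. p \<gamma> \<xi>) ` (nodes_on S \<xi> \<inter> underS \<kappa> \<beta>) \<subseteq> S"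
    by (auto simp: nodes_on_def)
  then have "Restr (Restr tree S) (underS (Restr tree S) (p \<beta> \<xi>)) =
      Restr tree ((\<lambda>\<gamma>. p \<gamma> \<xi>) ` (nodes_on S \<xi> \<inter> underS \<kappa> \<beta>))"
    unfolding eq by blast
  moreover have "nodes_on S \<xi> \<inter> underS \<kappa> \<beta> \<subseteq> Field \<kappa>"
    by (auto simp: nodes_on_def)
  ultimately show ?thesis
    using branch_segment_ordIso[OF _ assms(4)] by metis
qed

lemma in_subtree_level_iff:
  assumes "S \<subseteq> Field tree" "p \<beta> \<xi> \<in> S" "\<beta> \<in> Field \<kappa>" "\<xi> \<in> L"
  shows "p \<beta> \<xi> \<in> tree_level \<kappa> (Restr tree S) \<alpha> \<longleftrightarrow>
    Restr \<kappa> (nodes_on S \<xi> \<inter> underS \<kappa> \<beta>) =o Restr \<kappa> (underS \<kappa> \<alpha>)"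
  using subtree_height[OF assms] subtree_Field[OF assms(1)] assms(2)
  unfolding tree_level_def by (auto intro: ordIso_transitive ordIso_symmetric)

section \<open>The tree as its own subtree: levels and height\<close>

lemma Restr_tree_Field: "Restr tree (Field tree) = tree"
  by (auto simp: Field_def)

lemma nodes_on_Field_tree: "\<xi> \<in> L \<Longrightarrow> nodes_on (Field tree) \<xi> = Field \<kappa>"
  using node_in_Field by (auto simp: nodes_on_def)

lemma tree_height_node:
  assumes "\<beta> \<in> Field \<kappa>" "\<xi> \<in> L"
  shows "Restr \<kappa> (underS \<kappa> \<beta>) =o Restr tree (underS tree (p \<beta> \<xi>))"
proof -
  have "Field \<kappa> \<inter> underS \<kappa> \<beta> = underS \<kappa> \<beta>"
    using underS_subset by fastforce
  then show ?thesis
    using subtree_height[of "Field tree" \<beta> \<xi>] assms node_in_Field[OF assms]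
    by (simp add: Restr_tree_Field nodes_on_Field_tree)
qed

lemma tree_level_eq:
  assumes "\<alpha> \<in> Field \<kappa>"
  shows "tree_level \<kappa> tree \<alpha> = p \<alpha> ` L"
proof -
  have "p \<beta> \<xi> \<in> tree_level \<kappa> tree \<alpha> \<longleftrightarrow> \<beta> = \<alpha>" if "\<beta> \<in> Field \<kappa>" "\<xi> \<in> L" for \<beta> \<xi>
    unfolding tree_level_def
    using tree_height_node[OF that] underS_ordIso_iff[OF that(1) assms] node_in_Field[OF that]
    by (auto intro: ordIso_transitive ordIso_symmetric)
  moreover have "tree_level \<kappa> tree \<alpha> \<subseteq> Field tree"
    by (auto simp: tree_level_def)
  ultimately show ?thesis
    using assms by (auto elim!: nodeE)
qed

lemma tree_is_tree: "is_tree tree"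
  unfolding is_tree_def
proof (intro conjI ballI)
  fix t assume "t \<in> Field tree"
  then obtain \<alpha> \<xi> where "t = p \<alpha> \<xi>" "\<alpha> \<in> Field \<kappa>" "\<xi> \<in> L"
    by (rule nodeE)
  then show "Well_order (Restr tree (underS tree t))"
    using tree_height_node by (auto simp: ordIso_def)
qed (rule tree_partial_order)

lemma tree_has_height: "has_height \<kappa> tree"
  unfolding has_height_def
proof (intro conjI ballI)
  fix t assume "t \<in> Field tree"
  then obtain \<alpha> \<xi> where t: "t = p \<alpha> \<xi>" "\<alpha> \<in> Field \<kappa>" "\<xi> \<in> L"
    by (rule nodeE)
  then have "Restr \<kappa> (underS \<kappa> \<alpha>) <o \<kappa>"
    using underS_Restr_ordLess[OF well_order] by blast
  then show "Restr tree (underS tree t) <o \<kappa>"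
    using tree_height_node[OF t(2,3)] t(1) ordIso_ordLess_trans ordIso_symmetric by blast
qed (use tree_level_eq L_nonempty in auto)

lemma tree_small_levels: "small_levels \<kappa> tree"
  unfolding small_levels_def using tree_level_eq p_small by simp

section \<open>Branches of length \<kappa>, and subtrees without them\<close>

definition branch :: "'i \<Rightarrow> 't set" where
  "branch \<xi> = (\<lambda>\<gamma>. p \<gamma> \<xi>) ` Field \<kappa>"

text \<open>A chain that contains nodes of \<open>branch \<xi>\<close> at unboundedly many levels lies on \<open>branch \<xi>\<close>.\<close>

lemma unbounded_subset_branch:
  assumes S: "S \<subseteq> Field tree" and \<xi>: "\<xi> \<in> L"
    and unb: "\<And>\<beta>. \<beta> \<in> Field \<kappa> \<Longrightarrow> \<exists>\<alpha>\<in>nodes_on S \<xi>. \<alpha> \<notin> underS \<kappa> \<beta>"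
  shows "(\<lambda>\<gamma>. p \<gamma> \<xi>) ` nodes_on S \<xi> \<in> branches \<kappa> (Restr tree S)"
proof -
  let ?A = "nodes_on S \<xi>" and ?U = "Restr tree S"
  let ?b = "(\<lambda>\<gamma>. p \<gamma> \<xi>) ` ?A"
  have A: "?A \<subseteq> Field \<kappa>" and bS: "?b \<subseteq> S"
    by (auto simp: nodes_on_def)
  have "Restr ?U ?b = Restr tree ?b"
    using bS by blast
  then have "Restr ?U ?b =o \<kappa>"
    using branch_segment_ordIso[OF A \<xi>] unbounded_ordIso[OF A unb]
    by (metis ordIso_symmetric ordIso_transitive)
  moreover have "?b \<in> Chains ?U"
    unfolding Chains_def
    using bS A \<xi> wo.TOTALS by (auto simp: tree_iff subset_iff)
  moreover have "c = ?b" if c: "c \<in> Chains ?U" "?b \<subseteq> c" for c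
  proof -
    have "t \<in> ?b" if "t \<in> c" for t
    proof -
      have tS: "t \<in> S"
        using c(1) that unfolding Chains_def by blast
      then obtain \<beta> \<eta> where t: "t = p \<beta> \<eta>" "\<beta> \<in> Field \<kappa>" "\<eta> \<in> L"
        using S nodeE by blast
      obtain \<alpha> where \<alpha>: "\<alpha> \<in> ?A" "(\<beta>, \<alpha>) \<in> \<kappa>"
        using unb[OF t(2)] A t(2) wo.not_underS_iff by blast
      then have "p \<alpha> \<xi> \<in> c"
        using c(2) by blast
      then have "(t, p \<alpha> \<xi>) \<in> tree \<or> (p \<alpha> \<xi>, t) \<in> tree"
        using c(1) that unfolding Chains_def by blast
      then have "p \<beta> \<eta> = p \<beta> \<xi>"
        using t \<alpha> A \<xi> antisymD[OF wo.ANTISYM, of \<alpha> \<beta>] tree_iff[of \<alpha> \<beta> \<xi> \<eta>] tree_iff[of \<beta> \<alpha> \<eta> \<xi>]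
        by auto
      then show ?thesis
        using t tS by (auto simp: nodes_on_def)
    qed
    then show ?thesis
      using c(2) by blast
  qed
  ultimately show ?thesis
    by (simp add: branches_def)
qed

lemma branch_in_branches:
  assumes "\<xi> \<in> L"
  shows "branch \<xi> \<in> branches \<kappa> tree"
proof -
  have "\<exists>\<alpha>\<in>Field \<kappa>. \<alpha> \<notin> underS \<kappa> \<beta>" if "\<beta> \<in> Field \<kappa>" for \<beta>
    using that underS_notIn[of \<beta> \<kappa>] by blast
  then show ?thesis
    using unbounded_subset_branch[of "Field tree" \<xi>] assms
    by (simp add: nodes_on_Field_tree Restr_tree_Field branch_def)
qed

lemma branch_inj: "inj_on branch L"
proof (rule inj_onI, rule ccontr)
  fix \<xi> \<eta> assume *: "\<xi> \<in> L" "\<eta> \<in> L" "branch \<xi> = branch \<eta>" "\<xi> \<noteq> \<eta>"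
  then obtain \<alpha> where \<alpha>: "\<alpha> \<in> Field \<kappa>" "p \<alpha> \<xi> \<noteq> p \<alpha> \<eta>"
    using p_separated by blast
  then obtain \<beta> where "\<beta> \<in> Field \<kappa>" "p \<alpha> \<xi> = p \<beta> \<eta>"
    using *(3) unfolding branch_def by blast
  then show False
    using p_level[of \<alpha> \<beta> \<xi> \<eta>] * \<alpha> by auto
qed

text \<open>By maximality it suffices that \<open>s\<close> is comparable with every
  \<open>x\<close> in \<open>b\<close>. If \<open>x\<close> is above \<open>t\<close> this is
  transitivity; otherwise \<open>s\<close> and \<open>x\<close> both lie below \<open>t\<close>,
  hence on one branch.\<close>

lemma chain_down_closed:
  assumes b: "b \<in> branches \<kappa> tree" and "t \<in> b" "(s, t) \<in> tree"
  shows "s \<in> b"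
proof -
  have chain: "\<And>x y. x \<in> b \<Longrightarrow> y \<in> b \<Longrightarrow> (x, y) \<in> tree \<or> (y, x) \<in> tree"
    and max: "\<And>c. c \<in> Chains tree \<Longrightarrow> b \<subseteq> c \<Longrightarrow> c = b"
    using b unfolding branches_def Chains_def by auto
  have po: "trans tree" "Refl tree"
    using tree_partial_order tree_refl by (auto simp: partial_order_on_def preorder_on_def)
  have cmp: "(x, s) \<in> tree \<or> (s, x) \<in> tree" if "x \<in> b" for x
  proof (cases "(t, x) \<in> tree")
    case True
    then show ?thesis using assms(3) transD[OF po(1)] by blast
  next
    case False
    then have xt: "(x, t) \<in> tree"
      using chain that assms(2) by blast
    have "s \<in> Field tree" "x \<in> Field tree" "t \<in> Field tree"
      using xt assms(3) by (auto simp: Field_def)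
    then obtain \<alpha> \<xi> \<beta> \<eta> \<gamma> \<zeta> where *: "s = p \<alpha> \<xi>" "\<alpha> \<in> Field \<kappa>" "\<xi> \<in> L"
      "x = p \<beta> \<eta>" "\<beta> \<in> Field \<kappa>" "\<eta> \<in> L" "t = p \<gamma> \<zeta>" "\<gamma> \<in> Field \<kappa>" "\<zeta> \<in> L"
      by (metis nodeE)
    then have "s = p \<alpha> \<zeta>" "x = p \<beta> \<zeta>"
      using xt assms(3) by (auto simp: tree_iff)
    then show ?thesis
      using * wo.TOTALS by (auto simp: tree_iff)
  qed
  have "s \<in> Field tree"
    using assms(3) by (auto simp: Field_def)
  then have "insert s b \<in> Chains tree"
    using cmp chain po(2) unfolding Chains_def refl_on_def by blast
  then show ?thesis
    using max[of "insert s b"] by blast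
qed

text \<open>For a further branch \<open>b\<close>, let \<open>g \<xi>\<close> be a level at which
  the node of \<xi> is not in \<open>b\<close>, and let \<delta> reflect \<open>g\<close>. As
  \<open>b\<close> reaches level \<delta>, it meets there a branch \<eta> with
  \<open>g \<eta>\<close> below \<delta>, and so contains the node of \<eta> that it should
  omit.\<close>

lemma branches_eq: "branches \<kappa> tree = branch ` L"
proof (intro equalityI subsetI)
  fix b assume b: "b \<in> branches \<kappa> tree"
  show "b \<in> branch ` L"
  proof (rule ccontr)
    assume nb: "b \<notin> branch ` L"
    have chain: "\<And>x y. x \<in> b \<Longrightarrow> y \<in> b \<Longrightarrow> (x, y) \<in> tree \<or> (y, x) \<in> tree"
      and iso: "Restr tree b =o \<kappa>"
      using b unfolding branches_def Chains_def by auto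
    have bF: "b \<subseteq> Field tree"
      using chain by (auto simp: Field_def)
    have "\<exists>\<gamma>\<in>Field \<kappa>. p \<gamma> \<xi> \<notin> b" if "\<xi> \<in> L" for \<xi>
    proof (rule ccontr)
      assume "\<not> ?thesis"
      then have "branch \<xi> \<subseteq> b"
        by (auto simp: branch_def)
      then have "b = branch \<xi>"
        using branch_in_branches[OF that] b unfolding branches_def by auto
      then show False using nb that by blast
    qed
    then obtain g where g: "\<And>\<xi>. \<xi> \<in> L \<Longrightarrow> g \<xi> \<in> Field \<kappa> \<and> p (g \<xi>) \<xi> \<notin> b"
      by metis
    then obtain \<delta> where \<delta>: "\<delta> \<in> Field \<kappa>"
      "\<forall>\<xi>\<in>L. \<exists>\<eta>\<in>L. p \<delta> \<xi> = p \<delta> \<eta> \<and> g \<eta> \<in> underS \<kappa> \<delta>"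
      using p_reflect[of g "\<lambda>\<alpha>. \<alpha>"] by blast
    \<comment> \<open>Otherwise all levels of nodes of \<open>b\<close> are below \<delta>. Distinct
      nodes of a chain have distinct levels, so \<open>b\<close> would have fewer than \<kappa>
      elements.\<close>
    have "\<exists>\<alpha> \<zeta>. p \<alpha> \<zeta> \<in> b \<and> (\<delta>, \<alpha>) \<in> \<kappa> \<and> \<zeta> \<in> L"
    proof (rule ccontr)
      assume no: "\<not> ?thesis"
      have "\<exists>\<alpha> \<zeta>. t = p \<alpha> \<zeta> \<and> \<alpha> \<in> underS \<kappa> \<delta> \<and> \<zeta> \<in> L" if t: "t \<in> b" for t
      proof -
        obtain \<alpha> \<zeta> where "t = p \<alpha> \<zeta>" "\<alpha> \<in> Field \<kappa>" "\<zeta> \<in> L"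
          using subsetD[OF bF t] nodeE by blast
        then show ?thesis
          using no that wo.not_underS_iff \<delta>(1) by blast
      qed
      then obtain l where l: "\<And>t. t \<in> b \<Longrightarrow> l t \<in> underS \<kappa> \<delta> \<and> (\<exists>\<zeta>\<in>L. t = p (l t) \<zeta>)"
        by metis
      have "inj_on l b"
      proof (rule inj_onI)
        fix s t assume st: "s \<in> b" "t \<in> b" "l s = l t"
        then obtain \<xi> \<eta> where "\<xi> \<in> L" "\<eta> \<in> L" "s = p (l s) \<xi>" "t = p (l s) \<eta>"
          using l by metis
        moreover have "l s \<in> Field \<kappa>"
          using l[OF st(1)] underS_subset by fastforce
        ultimately show "s = t"
          using chain[OF st(1,2)] tree_iff by metis
      qed
      moreover have "l ` b \<subseteq> underS \<kappa> \<delta>"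
        using l by blast
      ultimately have "|b| \<le>o |underS \<kappa> \<delta>|"
        by (rule card_of_ordLeqI[OF _ subsetD]) auto
      then have "|b| <o \<kappa>"
        using small_underS[OF \<delta>(1)] ordLeq_ordLess_trans by blast
      moreover have "|b| =o |Field \<kappa>|"
        using card_of_cong[OF iso] Refl_Field_Restr2[OF tree_refl bF] by simp
      ultimately show False
        using card_of_Field_ordIso[OF card_order] not_ordLess_ordIso ordIso_transitive by blast
    qed
    then obtain \<alpha> \<zeta> where \<alpha>: "p \<alpha> \<zeta> \<in> b" "(\<delta>, \<alpha>) \<in> \<kappa>" "\<zeta> \<in> L"
      by blast
    then obtain \<eta> where \<eta>: "\<eta> \<in> L" "p \<delta> \<zeta> = p \<delta> \<eta>" "g \<eta> \<in> underS \<kappa> \<delta>"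
      using \<delta>(2) by blast
    \<comment> \<open>Since \<zeta> and \<eta> agree at \<delta>, they agree at level
      \<open>g \<eta>\<close>; the node there precedes a node of \<open>b\<close>.\<close>
    have *: "(g \<eta>, \<delta>) \<in> \<kappa>" "(g \<eta>, \<alpha>) \<in> \<kappa>" "\<alpha> \<in> Field \<kappa>"
      using \<eta>(3) \<alpha>(2) transD[OF wo.TRANS] by (auto simp: underS_def Field_def)
    have "(p (g \<eta>) \<zeta>, p \<alpha> \<zeta>) \<in> tree"
      using * g[OF \<eta>(1)] \<alpha>(3) by (simp add: tree_iff)
    then have "p (g \<eta>) \<zeta> \<in> b"
      using chain_down_closed[OF b \<alpha>(1)] by blast
    then show False
      using p_below[OF *(1) \<alpha>(3) \<eta>(1,2)] g[OF \<eta>(1)] by simp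
  qed
qed (use branch_in_branches in auto)

lemma card_branches: "|branches \<kappa> tree| =o |L|"
  unfolding branches_eq
  by (rule ordIso_symmetric, rule card_of_ordIsoI[of branch]) (simp add: bij_betw_def branch_inj)

text \<open>Let \<open>g \<xi>\<close> bound the levels at which the branch of \<xi> meets
  \<open>S\<close>, and let \<open>h \<alpha>\<close> bound the levels of the nodes that have height
  \<alpha> in the subtree. With \<delta> reflecting \<open>g\<close> and \<open>h\<close>, take
  \<open>s\<close> of height \<delta> in the subtree, on \<xi>, and \<eta> agreeing with \<xi> at
  \<delta>. The predecessor of \<open>s\<close> of height \<open>g \<eta>\<close> has a level
  \<gamma> below \<delta>, so it also lies on \<eta>, which puts \<gamma> below
  \<open>g \<eta>\<close>. But the level of a node is at least its height in the subtree.\<close>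

lemma no_aronszajn_subtree:
  assumes S: "S \<subseteq> Field tree"
  shows "\<not> aronszajn_tree \<kappa> (Restr tree S)"
proof
  let ?U = "Restr tree S"
  assume "aronszajn_tree \<kappa> ?U"
  then have nonempty: "\<And>\<alpha>. \<alpha> \<in> Field \<kappa> \<Longrightarrow> tree_level \<kappa> ?U \<alpha> \<noteq> {}"
    and small: "\<And>\<alpha>. \<alpha> \<in> Field \<kappa> \<Longrightarrow> |tree_level \<kappa> ?U \<alpha>| <o \<kappa>"
    and none: "branches \<kappa> ?U = {}"
    unfolding aronszajn_tree_def has_height_def small_levels_def by auto
  have sub: "nodes_on S \<xi> \<subseteq> Field \<kappa>" for \<xi>
    by (auto simp: nodes_on_def)
  \<comment> \<open>A branch meeting \<open>S\<close> at unboundedly many levels would give the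
    subtree a branch of length \<kappa>.\<close>
  have "\<exists>\<beta>\<in>Field \<kappa>. nodes_on S \<xi> \<subseteq> underS \<kappa> \<beta>" if "\<xi> \<in> L" for \<xi>
    using unbounded_subset_branch[OF S that] none by blast
  then obtain g where g: "\<And>\<xi>. \<xi> \<in> L \<Longrightarrow> g \<xi> \<in> Field \<kappa> \<and> nodes_on S \<xi> \<subseteq> underS \<kappa> (g \<xi>)"
    by metis
  \<comment> \<open>A level of the subtree is small, so regularity bounds the levels that its nodes
    have in the whole tree.\<close>
  have "\<exists>\<beta>\<in>Field \<kappa>. \<forall>\<gamma> \<xi>. \<gamma> \<in> Field \<kappa> \<and> \<xi> \<in> L \<and> p \<gamma> \<xi> \<in> tree_level \<kappa> ?U \<alpha> \<longrightarrow> \<gamma> \<in> underS \<kappa> \<beta>"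
    if \<alpha>: "\<alpha> \<in> Field \<kappa>" for \<alpha>
  proof -
    have "tree_level \<kappa> ?U \<alpha> \<subseteq> Field tree"
      using subtree_Field[OF S] S by (auto simp: tree_level_def)
    then have "\<forall>t\<in>tree_level \<kappa> ?U \<alpha>. \<exists>\<gamma>. \<gamma> \<in> Field \<kappa> \<and> (\<exists>\<xi>\<in>L. t = p \<gamma> \<xi>)"
      by (metis nodeE subsetD)
    then obtain l where l: "\<And>t. t \<in> tree_level \<kappa> ?U \<alpha> \<Longrightarrow> l t \<in> Field \<kappa> \<and> (\<exists>\<xi>\<in>L. t = p (l t) \<xi>)"
      by metis
    then obtain \<beta> where \<beta>: "\<beta> \<in> Field \<kappa>" "\<And>\<gamma>. \<gamma> \<in> l ` tree_level \<kappa> ?U \<alpha> \<Longrightarrow> \<gamma> \<in> underS \<kappa> \<beta>"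
      using small_bounded[OF _ small_image[OF small[OF \<alpha>]], of l] by blast
    have "\<gamma> \<in> underS \<kappa> \<beta>" if "\<gamma> \<in> Field \<kappa>" "\<xi> \<in> L" "p \<gamma> \<xi> \<in> tree_level \<kappa> ?U \<alpha>" for \<gamma> \<xi>
    proof -
      have "l (p \<gamma> \<xi>) = \<gamma>"
        using l[OF that(3)] p_level that(1,2) by metis
      then show ?thesis
        using \<beta>(2) that(3) by (metis imageI)
    qed
    then show ?thesis
      using \<beta>(1) by blast
  qed
  then obtain h where h: "\<And>\<alpha>. \<alpha> \<in> Field \<kappa> \<Longrightarrow> h \<alpha> \<in> Field \<kappa>"
    "\<And>\<alpha> \<gamma> \<xi>. \<alpha> \<in> Field \<kappa> \<Longrightarrow> \<gamma> \<in> Field \<kappa> \<Longrightarrow> \<xi> \<in> L \<Longrightarrow> p \<gamma> \<xi> \<in> tree_level \<kappa> ?U \<alpha> \<Longrightarrow> \<gamma> \<in> underS \<kappa> (h \<alpha>)"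
    by metis
  obtain \<delta> where \<delta>: "\<delta> \<in> Field \<kappa>" "\<And>\<alpha>. \<alpha> \<in> underS \<kappa> \<delta> \<Longrightarrow> h \<alpha> \<in> underS \<kappa> \<delta>"
    "\<And>\<xi>. \<xi> \<in> L \<Longrightarrow> \<exists>\<eta>\<in>L. p \<delta> \<xi> = p \<delta> \<eta> \<and> g \<eta> \<in> underS \<kappa> \<delta>"
    using p_reflect[of g h] g h(1) by blast
  obtain s where s: "s \<in> tree_level \<kappa> ?U \<delta>"
    using nonempty[OF \<delta>(1)] by blast
  then have sS: "s \<in> S"
    using subtree_Field[OF S] by (auto simp: tree_level_def)
  then obtain \<beta> \<xi> where \<beta>: "s = p \<beta> \<xi>" "\<beta> \<in> Field \<kappa>" "\<xi> \<in> L"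
    using S nodeE by blast
  obtain \<eta> where \<eta>: "\<eta> \<in> L" "p \<delta> \<xi> = p \<delta> \<eta>" "g \<eta> \<in> underS \<kappa> \<delta>"
    using \<delta>(3)[OF \<beta>(3)] by blast
  let ?A = "nodes_on S \<xi> \<inter> underS \<kappa> \<beta>"
  have A: "?A \<subseteq> Field \<kappa>" and U: "underS \<kappa> \<delta> \<subseteq> Field \<kappa>"
    using sub underS_subset by auto
  have "Restr \<kappa> (underS \<kappa> \<delta>) =o Restr \<kappa> ?A"
    using in_subtree_level_iff[OF S, of \<beta> \<xi> \<delta>] s sS \<beta> ordIso_symmetric by blast
  then obtain f where f: "iso (Restr \<kappa> (underS \<kappa> \<delta>)) (Restr \<kappa> ?A) f"
    unfolding ordIso_Restr_iff[OF well_order well_order] by blast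
  have fA: "f ` underS \<kappa> \<delta> = ?A"
    using f by (simp add: iso_Restr_iff[OF wo.REFL wo.REFL U A] bij_betw_def)
  \<comment> \<open>The predecessor of \<open>s\<close> in the subtree whose height there is \<open>g \<eta>\<close>.\<close>
  define \<gamma> where "\<gamma> = f (g \<eta>)"
  have \<gamma>: "\<gamma> \<in> nodes_on S \<xi>" "\<gamma> \<in> underS \<kappa> \<beta>" "\<gamma> \<in> Field \<kappa>"
    using fA \<eta>(3) A unfolding \<gamma>_def by blast+
  have "underS \<kappa> \<delta> \<inter> underS \<kappa> (g \<eta>) = underS \<kappa> (g \<eta>)"
    using wo.underS_mono[OF \<eta>(3)] by blast
  moreover have "?A \<inter> underS \<kappa> \<gamma> = nodes_on S \<xi> \<inter> underS \<kappa> \<gamma>"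
    using wo.underS_mono[OF \<gamma>(2)] by blast
  ultimately have lev: "Restr \<kappa> (underS \<kappa> (g \<eta>)) =o Restr \<kappa> (nodes_on S \<xi> \<inter> underS \<kappa> \<gamma>)"
    using iso_Restr_underS[OF well_order well_order U A f subset_refl \<eta>(3)] fA
    unfolding \<gamma>_def by simp
  have "p \<gamma> \<xi> \<in> tree_level \<kappa> ?U (g \<eta>)"
    using in_subtree_level_iff[OF S _ \<gamma>(3) \<beta>(3)] \<gamma>(1) ordIso_symmetric[OF lev]
    by (auto simp: nodes_on_def)
  then have "\<gamma> \<in> underS \<kappa> (h (g \<eta>))"
    using h(2) \<gamma>(3) \<beta>(3) g \<eta>(1) by blast
  moreover have "h (g \<eta>) \<in> underS \<kappa> \<delta>"
    using \<delta>(2) \<eta>(3) by blast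
  ultimately have "(\<gamma>, \<delta>) \<in> \<kappa>"
    using transD[OF wo.TRANS] by (auto simp: underS_def)
  then have "p \<gamma> \<xi> = p \<gamma> \<eta>"
    using p_below \<beta>(3) \<eta>(1,2) by blast
  then have "\<gamma> \<in> nodes_on S \<eta>"
    using \<gamma>(1) by (simp add: nodes_on_def)
  then have less: "\<gamma> \<in> underS \<kappa> (g \<eta>)"
    using g \<eta>(1) by blast
  \<comment> \<open>The height of \<open>p \<gamma> \<xi>\<close> in the subtree, which is
    \<open>g \<eta>\<close>, is at most its level \<gamma>.\<close>
  have "Restr \<kappa> (nodes_on S \<xi> \<inter> underS \<kappa> \<gamma>) \<le>o Restr \<kappa> (underS \<kappa> \<gamma>)"
    using wo.Restr_mono_ordLeq[of _ "underS \<kappa> \<gamma>"] underS_subset by (metis inf_le2)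
  then have "Restr \<kappa> (underS \<kappa> (g \<eta>)) \<le>o Restr \<kappa> (underS \<kappa> \<gamma>)"
    using lev ordIso_ordLeq_trans by blast
  moreover have "Restr \<kappa> (underS \<kappa> \<gamma>) \<le>o Restr \<kappa> (underS \<kappa> (g \<eta>))"
    using wo.Restr_mono_ordLeq[OF wo.underS_mono[OF less] underS_subset] .
  ultimately have "\<gamma> = g \<eta>"
    using underS_ordIso_iff[OF \<gamma>(3), of "g \<eta>"] g[OF \<eta>(1)] by (simp add: ordIso_iff_ordLeq)
  then show False
    using less by (simp add: underS_def)
qed

end


section \<open>Stationary \<open>(\<kappa>, \<kappa>\<^sup>+)\<close>-cardinals\<close>

text \<open>Stated for a well-order \<open>lam\<close> with at least \<kappa> elements; the
  successor cardinal is substituted for it in the final theorem.\<close>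

locale stationary_two_cardinal = regular_cardinal \<kappa> for \<kappa> :: "'k rel" +
  fixes lam :: "'o rel" and \<mu> :: "'o set set"
  assumes lam_well_order: "Well_order lam"
    and lam_large: "\<not> |Field lam| <o \<kappa>"
    and two_cardinal: "two_cardinal \<kappa> lam \<mu>"
    and stationary: "stationary_sets \<kappa> lam \<mu>"
begin

sublocale lam: wo_rel lam
  using lam_well_order by (simp add: wo_rel_def)

abbreviation rk :: "'o set \<Rightarrow> 'k" where
  "rk \<equiv> rank \<kappa> \<mu>"

abbreviation seg :: "'o set \<Rightarrow> 'o \<Rightarrow> 'o set" where
  "seg X \<xi> \<equiv> X \<inter> underS lam \<xi>"

subsection \<open>Ranks\<close>

lemma mem_small_sets: "\<mu> \<subseteq> small_sets \<kappa> lam"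
  and wf_mem: "wf (incl_rel \<mu>)"
  and below_small: "\<forall>X\<in>\<mu>. |below \<mu> X| <o \<kappa>"
  and homogeneous: "\<forall>X\<in>\<mu>. \<forall>Y\<in>\<mu>. rk X = rk Y \<longrightarrow>
    same_otp lam X Y \<and> below \<mu> Y = {order_bij lam Y X ` Z | Z. Z \<in> below \<mu> X}"
  and mem_directed: "directed \<mu>"
  and directed_or_is_star: "\<forall>X\<in>\<mu>. directed (below \<mu> X) \<or>
    (\<exists>X1\<in>\<mu>. \<exists>X2\<in>\<mu>. rk X1 = rk X2 \<and> is_star lam X X1 X2 \<and>
      below \<mu> X = below \<mu> X1 \<union> below \<mu> X2 \<union> {X1, X2})"
  and Union_below: "\<forall>X\<in>\<mu>. rk X \<noteq> wo.minim (Field \<kappa>) \<longrightarrow> X = \<Union>(below \<mu> X)"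
  using two_cardinal unfolding two_cardinal_def by - (elim conjE, assumption)+

lemma mem_subset: "X \<in> \<mu> \<Longrightarrow> X \<subseteq> Field lam"
  and mem_small: "X \<in> \<mu> \<Longrightarrow> |X| <o \<kappa>"
  using mem_small_sets unfolding small_sets_def by blast+

lemma mem_induct [consumes 1, case_names less]:
  assumes "X \<in> \<mu>" and "\<And>X. X \<in> \<mu> \<Longrightarrow> (\<And>Y. Y \<in> \<mu> \<Longrightarrow> Y \<subset> X \<Longrightarrow> P Y) \<Longrightarrow> P X"
  shows "P X"
  using wf_mem assms(1)
proof (induction X rule: wf_induct_rule)
  case (less X)
  then show ?case
    using assms(2)[of X] by (simp add: incl_rel_def below_def)
qed

lemmas rk_step = rank_step[OF Cinf reg wf_mem below_small]

lemma rk_Field: "X \<in> \<mu> \<Longrightarrow> rk X \<in> Field \<kappa>"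
  by (rule rk_step)

lemma rk_below_subset: "rk ` below \<mu> X \<subseteq> Field \<kappa>"
  using rk_Field by (auto simp: below_def)

lemma rk_less:
  assumes "X \<in> \<mu>" "Y \<in> \<mu>" "Y \<subset> X"
  shows "rk Y \<in> underS \<kappa> (rk X)"
proof -
  have "rk Y \<in> rk ` below \<mu> X"
    using assms by (simp add: below_def)
  from wo.suc_greater[OF rk_below_subset rk_step(3)[OF assms(1)] this]
  show ?thesis
    using rk_step(2)[OF assms(1)] by (auto simp: underS_def)
qed

lemma rk_refl: "X \<in> \<mu> \<Longrightarrow> (rk X, rk X) \<in> \<kappa>"
  using rk_Field wo.REFL by (auto simp: refl_on_def)

lemma rk_mono: "X \<in> \<mu> \<Longrightarrow> Y \<in> \<mu> \<Longrightarrow> Y \<subseteq> X \<Longrightarrow> (rk Y, rk X) \<in> \<kappa>"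
  using rk_less[of X Y] rk_refl[of X] by (cases "Y = X") (auto simp: underS_def)

lemma rk_eq_subset: "X \<in> \<mu> \<Longrightarrow> Y \<in> \<mu> \<Longrightarrow> Y \<subseteq> X \<Longrightarrow> rk Y = rk X \<Longrightarrow> Y = X"
  using rk_less[of X Y] by (auto simp: underS_def)

text \<open>The rank of \<open>X\<close> is the least strict upper bound of the ranks below
  \<open>X\<close>, so a smaller \<open>a\<close> is no such bound.\<close>

lemma rk_approx:
  assumes "X \<in> \<mu>" "a \<in> underS \<kappa> (rk X)"
  shows "\<exists>Y\<in>\<mu>. Y \<subset> X \<and> (a, rk Y) \<in> \<kappa>"
proof (rule ccontr)
  assume no: "\<not> ?thesis"
  have a: "a \<in> Field \<kappa>"
    using assms(2) underS_subset by blast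
  have "b \<in> underS \<kappa> a" if "b \<in> rk ` below \<mu> X" for b
    using that no wo.not_underS_iff[OF _ a, of b] rk_Field by (auto simp: below_def)
  then have "a \<in> AboveS \<kappa> (rk ` below \<mu> X)"
    using a by (auto simp: AboveS_def underS_def)
  then have "(rk X, a) \<in> \<kappa>"
    using wo.suc_least_AboveS rk_step(2)[OF assms(1)] by metis
  then show False
    using assms(2) a rk_Field[OF assms(1)] wo.not_underS_iff by blast
qed

text \<open>Homogeneity provides \<open>f\<close> and the images of the members below
  \<open>X\<close>. Ranks are preserved by induction, because \<open>f\<close> is an inclusion
  isomorphism between the members below \<open>X\<close> and those below \<open>Y\<close>.\<close>

lemma same_rank_iso:
  assumes "X \<in> \<mu>" "Y \<in> \<mu>" "rk X = rk Y"
  obtains f where "iso (Restr lam X) (Restr lam Y) f"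
    and "\<And>Z. Z \<in> \<mu> \<Longrightarrow> Z \<subseteq> X \<Longrightarrow> f ` Z \<in> \<mu> \<and> f ` Z \<subseteq> Y \<and> rk (f ` Z) = rk Z"
proof -
  define f where "f = order_bij lam Y X"
  have "same_otp lam X Y" and "below \<mu> Y = {f ` Z | Z. Z \<in> below \<mu> X}"
    using homogeneous assms unfolding f_def by blast+
  then have im: "below \<mu> Y = (`) f ` below \<mu> X" and "\<exists>f. iso (Restr lam X) (Restr lam Y) f"
    unfolding same_otp_def ordIso_Restr_iff[OF lam_well_order lam_well_order] by blast+
  from someI_ex[OF this(2)] have f: "iso (Restr lam X) (Restr lam Y) f"
    unfolding f_def order_bij_def .
  then have bij: "bij_betw f X Y"
    using iso_Restr_iff[OF lam.REFL lam.REFL] mem_subset assms by metis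
  have im': "below \<mu> (f ` Z) = (`) f ` below \<mu> Z" if Z: "Z \<in> below \<mu> X" for Z
  proof -
    have inj: "f ` V \<subset> f ` Z \<longleftrightarrow> V \<subset> Z" if "V \<subseteq> X" for V
    proof -
      have ZX: "Z \<subseteq> X" and "inj_on f X"
        using Z bij by (auto simp: below_def bij_betw_def)
      then have "f ` V \<subseteq> f ` Z \<longleftrightarrow> V \<subseteq> Z" "f ` V = f ` Z \<longleftrightarrow> V = Z"
        using inj_on_image_mem_iff[of f X _ Z] inj_on_image_eq_iff[of f X V Z] that by blast+
      then show ?thesis
        by (simp add: psubset_eq)
    qed
    have "f ` Z \<in> below \<mu> Y"
      using im Z by blast
    then have "below \<mu> (f ` Z) = {W \<in> below \<mu> Y. W \<subset> f ` Z}"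
      by (auto simp: below_def)
    also have "\<dots> = (`) f ` {V \<in> below \<mu> X. f ` V \<subset> f ` Z}"
      unfolding im by blast
    also have "{V \<in> below \<mu> X. f ` V \<subset> f ` Z} = {V \<in> below \<mu> X. V \<subset> Z}"
      by (intro Collect_cong conj_cong refl inj) (auto simp: below_def)
    also have "\<dots> = below \<mu> Z"
      using Z by (auto simp: below_def)
    finally show ?thesis .
  qed
  have rk_f: "Z \<in> below \<mu> X \<longrightarrow> rk (f ` Z) = rk Z" if "Z \<in> \<mu>" for Z
    using that
  proof (induction rule: mem_induct)
    case (less Z)
    show ?case
    proof
      assume Z: "Z \<in> below \<mu> X"
      have "rk ` below \<mu> (f ` Z) = rk ` below \<mu> Z"
        unfolding im'[OF Z] image_image
        using less.IH Z by (intro image_cong) (auto simp: below_def)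
      moreover have "f ` Z \<in> \<mu>"
        using subsetD[OF equalityD2[OF im] imageI[OF Z]] by (simp add: below_def)
      ultimately show "rk (f ` Z) = rk Z"
        using rk_step(2) less.hyps by metis
    qed
  qed
  show thesis
  proof (rule that[OF f])
    fix Z assume Z: "Z \<in> \<mu>" "Z \<subseteq> X"
    show "f ` Z \<in> \<mu> \<and> f ` Z \<subseteq> Y \<and> rk (f ` Z) = rk Z"
    proof (cases "Z = X")
      case True
      then show ?thesis
        using bij assms by (simp add: bij_betw_def)
    next
      case False
      then have "Z \<in> below \<mu> X"
        using Z by (auto simp: below_def)
      moreover from this have "f ` Z \<in> below \<mu> Y"
        using im by blast
      ultimately show ?thesis
        using rk_f Z by (auto simp: below_def)
    qed
  qed
qed

lemma directed_or_star:
  assumes "X \<in> \<mu>"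
  obtains (directed) "\<And>A B. A \<in> \<mu> \<Longrightarrow> B \<in> \<mu> \<Longrightarrow> A \<subset> X \<Longrightarrow> B \<subset> X \<Longrightarrow> \<exists>C\<in>\<mu>. C \<subset> X \<and> A \<union> B \<subseteq> C"
  | (star) X1 X2 where "X1 \<in> \<mu>" "X2 \<in> \<mu>" "X1 \<subset> X" "X2 \<subset> X" "rk X1 = rk X2"
    "\<And>A. A \<in> \<mu> \<Longrightarrow> A \<subset> X \<Longrightarrow> A \<subseteq> X1 \<or> A \<subseteq> X2"
    "\<And>\<xi> d. d \<in> X1 \<inter> X2 \<Longrightarrow> \<xi> \<in> X1 \<union> X2 \<Longrightarrow> \<xi> \<in> underS lam d \<Longrightarrow> \<xi> \<in> X1 \<inter> X2"
proof -
  from bspec[OF directed_or_is_star assms] show thesis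
  proof (elim disjE bexE conjE)
    assume dir: "directed (below \<mu> X)"
    show thesis
    proof (rule directed)
      fix A B assume "A \<in> \<mu>" "B \<in> \<mu>" "A \<subset> X" "B \<subset> X"
      then have "A \<in> below \<mu> X" "B \<in> below \<mu> X"
        by (auto simp: below_def)
      with dir obtain C where "C \<in> below \<mu> X" "A \<union> B \<subseteq> C"
        unfolding directed_def by blast
      then show "\<exists>C\<in>\<mu>. C \<subset> X \<and> A \<union> B \<subseteq> C"
        by (auto simp: below_def)
    qed
  next
    fix X1 X2 assume X12: "X1 \<in> \<mu>" "X2 \<in> \<mu>" "rk X1 = rk X2"
      and st: "is_star lam X X1 X2" and bel: "below \<mu> X = below \<mu> X1 \<union> below \<mu> X2 \<union> {X1, X2}"
    have "X1 \<in> below \<mu> X" "X2 \<in> below \<mu> X"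
      unfolding bel by blast+
    then have sub: "X1 \<subset> X" "X2 \<subset> X"
      unfolding below_def by blast+
    have lt: "\<And>\<alpha> \<beta>. \<alpha> \<in> X1 \<inter> X2 \<Longrightarrow> \<beta> \<in> X1 - X2 \<Longrightarrow> \<alpha> \<in> underS lam \<beta>"
      "\<And>\<alpha> \<beta>. \<alpha> \<in> X1 - X2 \<Longrightarrow> \<beta> \<in> X2 - X1 \<Longrightarrow> \<alpha> \<in> underS lam \<beta>" and un: "X = X1 \<union> X2"
      using st unfolding is_star_def set_less_def underS_def by blast+
    \<comment> \<open>This point exists because \<open>X2\<close> is a proper subset of
      \<open>X\<close>. It links \<open>X1 \<inter> X2\<close> with \<open>X2 - X1\<close>, which
      are ordered only through \<open>X1 - X2\<close>.\<close>
    obtain \<gamma> where \<gamma>: "\<gamma> \<in> X1 - X2"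
      using un sub by blast
    have asym: "\<alpha> \<notin> underS lam \<beta>" if "\<beta> \<in> underS lam \<alpha>" for \<alpha> \<beta>
      using that lam.ANTISYM unfolding underS_def antisym_def by blast
    show thesis
    proof (rule star[OF X12(1,2) sub X12(3)])
      fix A assume "A \<in> \<mu>" "A \<subset> X"
      then have "A \<in> below \<mu> X"
        by (simp add: below_def)
      then show "A \<subseteq> X1 \<or> A \<subseteq> X2"
        unfolding bel by (auto simp: below_def)
    next
      fix \<xi> d assume d: "d \<in> X1 \<inter> X2" and \<xi>: "\<xi> \<in> X1 \<union> X2" "\<xi> \<in> underS lam d"
      have "\<xi> \<notin> X1 - X2"
        using lt(1)[OF d] asym \<xi>(2) by blast
      moreover have "\<xi> \<notin> X2 - X1"
      proof
        assume "\<xi> \<in> X2 - X1"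
        then have "\<gamma> \<in> underS lam \<xi>"
          using lt(2) \<gamma> by blast
        then have "\<gamma> \<in> underS lam d"
          using lam.underS_mono[OF \<xi>(2)] by blast
        then show False
          using lt(1)[OF d \<gamma>] asym by blast
      qed
      ultimately show "\<xi> \<in> X1 \<inter> X2"
        using \<xi>(1) by blast
    qed
  qed
qed

subsection \<open>Coherence and interpolation\<close>

text \<open>In the splitting case, the isomorphism from \<open>Z1\<close> onto \<open>Z2\<close> fixes \<open>Z1 \<inter> Z2\<close>
  and moves \<open>X\<close> into \<open>Z2\<close>, so that the induction hypothesis for \<open>Z2\<close> applies.\<close>

lemma coherent:
  assumes "X \<in> \<mu>" "Y \<in> \<mu>" "rk X = rk Y" "\<xi> \<in> X" "\<xi> \<in> Y"
  shows "seg X \<xi> = seg Y \<xi>"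
proof -
  \<comment> \<open>The induction runs over a member \<open>Z\<close> that contains both sets;
    directedness of \<mu> supplies one in the end.\<close>
  have "\<forall>X Y \<xi>. X \<in> \<mu> \<longrightarrow> Y \<in> \<mu> \<longrightarrow> X \<subseteq> Z \<longrightarrow> Y \<subseteq> Z \<longrightarrow> rk X = rk Y \<longrightarrow> \<xi> \<in> X \<longrightarrow> \<xi> \<in> Y \<longrightarrow>
      seg X \<xi> = seg Y \<xi>" if "Z \<in> \<mu>" for Z
    using that
  proof (induction rule: mem_induct)
    case (less Z)
    show ?case
    proof (intro allI impI)
      fix X Y \<xi>
      assume XY: "X \<in> \<mu>" "Y \<in> \<mu>" "X \<subseteq> Z" "Y \<subseteq> Z" "rk X = rk Y" "\<xi> \<in> X" "\<xi> \<in> Y"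
      show "seg X \<xi> = seg Y \<xi>"
      proof (cases "X = Z \<or> Y = Z")
        case True
        then have "X = Y"
          using XY rk_eq_subset[of X Y] rk_eq_subset[of Y X] by auto
        then show ?thesis by simp
      next
        case False
        then have sub: "X \<subset> Z" "Y \<subset> Z"
          using XY by auto
        show ?thesis
          using \<open>Z \<in> \<mu>\<close>
        proof (cases rule: directed_or_star)
          case directed
          obtain C where "C \<in> \<mu>" "C \<subset> Z" "X \<union> Y \<subseteq> C"
            using directed[OF XY(1,2) sub] by blast
          then show ?thesis
            using less.IH[of C] XY by blast
        next
          case (star Z1 Z2)
          note initial = star(7)
          have cross: "seg X \<xi> = seg Y \<xi>"
            if XY: "X \<in> \<mu>" "Y \<in> \<mu>" "rk X = rk Y" "\<xi> \<in> X" "\<xi> \<in> Y" "X \<subseteq> Z1" "Y \<subseteq> Z2" for X Y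
          proof -
            obtain f where f: "iso (Restr lam Z1) (Restr lam Z2) f"
              and fm: "\<And>Z. Z \<in> \<mu> \<Longrightarrow> Z \<subseteq> Z1 \<Longrightarrow> f ` Z \<in> \<mu> \<and> f ` Z \<subseteq> Z2 \<and> rk (f ` Z) = rk Z"
              using same_rank_iso[OF star(1,2,5)] by blast
            have \<xi>: "\<xi> \<in> Z1 \<inter> Z2" "\<xi> \<in> Z1"
              using XY by auto
            have fix_D: "f d = d" if "d \<in> Z1 \<inter> Z2" for d
              using lam.iso_Restr_fixes_common_segment[OF mem_subset[OF star(1)] mem_subset[OF star(2)] f
                  subset_refl _ that] initial by blast
            have seg_sub: "seg X \<xi> \<subseteq> Z1 \<inter> Z2"
              using initial[OF \<xi>(1)] XY(6) by blast
            have "seg (f ` X) \<xi> = f ` seg X \<xi>"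
              using iso_Restr_image_underS[OF lam.REFL lam.REFL mem_subset[OF star(1)] mem_subset[OF star(2)] f XY(6) \<xi>(2)]
                fix_D[OF \<xi>(1)] by simp
            also have "\<dots> = seg X \<xi>"
              using fix_D seg_sub by (auto simp: image_iff subset_iff)
            finally have eq: "seg (f ` X) \<xi> = seg X \<xi>" .
            have "\<xi> \<in> f ` X"
              using fix_D[OF \<xi>(1)] XY(4) by (metis imageI)
            then have "seg (f ` X) \<xi> = seg Y \<xi>"
              using less.IH[OF star(2,4), rule_format, of "f ` X" Y \<xi>] fm[OF XY(1,6)] XY(2,3,5,7) by simp
            then show ?thesis
              using eq by simp
          qed
          show ?thesis
            using star(6)[OF XY(1) sub(1)] star(6)[OF XY(2) sub(2)]
              less.IH[OF star(1,3)] less.IH[OF star(2,4)] cross[of X Y] cross[of Y X] XY by metis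
        qed
      qed
    qed
  qed
  moreover obtain Z where "Z \<in> \<mu>" "X \<union> Y \<subseteq> Z"
    using mem_directed assms unfolding directed_def by blast
  ultimately show ?thesis
    using assms by (metis Un_subset_iff)
qed

text \<open>Induction on \<open>X\<close>. For \<open>a\<close> below the rank of \<open>X\<close>
  it suffices to find a proper \<open>V\<close> of rank at least \<open>a\<close> containing
  \<open>Y\<close>. Some \<open>W\<close> below \<open>X\<close> has rank at least \<open>a\<close>:
  in the directed case \<open>V\<close> contains \<open>W\<close> and \<open>Y\<close>; in the
  splitting case both halves have rank at least that of \<open>W\<close>, and one of them contains
  \<open>Y\<close>.\<close>

lemma interpolate:
  assumes "X \<in> \<mu>" "Y \<in> \<mu>" "Y \<subseteq> X" "(rk Y, a) \<in> \<kappa>" "(a, rk X) \<in> \<kappa>"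
  shows "\<exists>Z\<in>\<mu>. Y \<subseteq> Z \<and> Z \<subseteq> X \<and> rk Z = a"
  using assms(1,3,5)
proof (induction rule: mem_induct)
  case (less X)
  have a: "a \<in> Field \<kappa>"
    using assms(4) by (auto simp: Field_def)
  show ?case
  proof (cases "a = rk X")
    case True
    then show ?thesis
      using less by auto
  next
    case False
    then have "a \<in> underS \<kappa> (rk X)"
      using less.prems by (simp add: underS_def)
    then obtain W where W: "W \<in> \<mu>" "W \<subset> X" "(a, rk W) \<in> \<kappa>"
      using rk_approx[OF less.hyps] by blast
    have "Y \<noteq> X"
      using False assms(4) less.prems(2) antisymD[OF wo.ANTISYM] by blast
    then have Y: "Y \<subset> X"
      using less.prems(1) by blast
    have "\<exists>V\<in>\<mu>. V \<subset> X \<and> Y \<subseteq> V \<and> (a, rk V) \<in> \<kappa>"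
      using less.hyps
    proof (cases rule: directed_or_star)
      case directed
      obtain V where V: "V \<in> \<mu>" "V \<subset> X" "W \<union> Y \<subseteq> V"
        using directed[OF W(1) assms(2) W(2) Y] by blast
      then have "(rk W, rk V) \<in> \<kappa>"
        using rk_mono W(1) by blast
      then show ?thesis
        using V transD[OF wo.TRANS W(3)] by blast
    next
      case (star X1 X2)
      have "(rk W, rk X1) \<in> \<kappa>"
        using star(6)[OF W(1,2)] rk_mono[OF star(1) W(1)] rk_mono[OF star(2) W(1)] star(5) by auto
      then have "(a, rk X1) \<in> \<kappa>" "(a, rk X2) \<in> \<kappa>"
        using transD[OF wo.TRANS W(3)] star(5) by auto
      then show ?thesis
        using star(6)[OF assms(2) Y] star(1-4) by blast
    qed
    then obtain V where V: "V \<in> \<mu>" "V \<subset> X" "Y \<subseteq> V" "(a, rk V) \<in> \<kappa>"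
      by blast
    then show ?thesis
      using less.IH[OF V(1,2,3,4)] by blast
  qed
qed

text \<open>A set of nonzero rank is the union of the members below it, so \<xi> lies in a proper
  \<open>V\<close>. If the rank of \<open>V\<close> is at least \<open>a\<close>, induction applies
  to \<open>V\<close>; otherwise \<open>interpolate\<close> applies between \<open>V\<close> and
  \<open>X\<close>.\<close>

lemma point_below:
  assumes "X \<in> \<mu>" "\<xi> \<in> X" "(a, rk X) \<in> \<kappa>"
  shows "\<exists>Y\<in>\<mu>. \<xi> \<in> Y \<and> Y \<subseteq> X \<and> rk Y = a"
  using assms
proof (induction rule: mem_induct)
  case (less X)
  have a: "a \<in> Field \<kappa>"
    using less.prems(2) by (auto simp: Field_def)
  show ?case
  proof (cases "a = rk X")
    case True
    then show ?thesis
      using less by auto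
  next
    case False
    then have "a \<in> underS \<kappa> (rk X)"
      using less.prems by (simp add: underS_def)
    then have "rk X \<noteq> wo.minim (Field \<kappa>)"
      using a wo.minim_least[OF subset_refl a] antisymD[OF wo.ANTISYM] by (auto simp: underS_def)
    then have "X = \<Union>(below \<mu> X)"
      using Union_below less.hyps by blast
    then obtain V where V: "V \<in> \<mu>" "V \<subset> X" "\<xi> \<in> V"
      using less.prems(1) by (auto simp: below_def)
    show ?thesis
    proof (cases "(a, rk V) \<in> \<kappa>")
      case True
      then show ?thesis
        using less.IH[OF V] V(2) by blast
    next
      case False
      then have "(rk V, a) \<in> \<kappa>"
        using wo.TOTALS a rk_Field[OF V(1)] by blast
      then show ?thesis
        using interpolate[OF less.hyps V(1) _ _ less.prems(2)] V by blast
    qed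
  qed
qed

text \<open>The small supersets of \<open>X\<close> form a club.\<close>

lemma small_covered:
  assumes "X \<subseteq> Field lam" "|X| <o \<kappa>"
  shows "\<exists>Y\<in>\<mu>. X \<subseteq> Y"
proof -
  let ?C = "{Y \<in> small_sets \<kappa> lam. X \<subseteq> Y}"
  have "club_sets \<kappa> lam ?C"
    unfolding club_sets_def
  proof (intro conjI ballI allI impI)
    fix Y assume "Y \<in> small_sets \<kappa> lam"
    then have "X \<union> Y \<in> ?C"
      using assms small_Un by (auto simp: small_sets_def)
    then show "\<exists>Z\<in>?C. Y \<subseteq> Z" by blast
  next
    fix D assume D: "D \<subseteq> ?C \<and> D \<noteq> {} \<and> chain\<^sub>\<subseteq> D \<and> |D| <o \<kappa>"
    then have "|\<Union>D| <o \<kappa>"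
      using small_UNION[of D "\<lambda>Y. Y"] by (auto simp: small_sets_def)
    then show "\<Union>D \<in> ?C"
      using D by (auto simp: small_sets_def)
  qed auto
  then show ?thesis
    using stationary unfolding stationary_sets_def by blast
qed

text \<open>If the ranks were bounded, the union of one member \<open>X c\<close> for each rank
  \<open>c\<close> would be small. A member \<open>Y\<close> containing this union and one more
  point would properly contain a member of its own rank.\<close>

lemma ranks_unbounded:
  assumes a: "a \<in> Field \<kappa>"
  shows "\<exists>X\<in>\<mu>. (a, rk X) \<in> \<kappa>"
proof (rule ccontr)
  assume "\<not> ?thesis"
  then have R: "rk ` \<mu> \<subseteq> underS \<kappa> a"
    using wo.not_underS_iff[OF _ a] rk_Field by blast
  have "\<forall>c\<in>rk ` \<mu>. \<exists>X. X \<in> \<mu> \<and> rk X = c"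
    by blast
  then obtain X where X: "\<And>c. c \<in> rk ` \<mu> \<Longrightarrow> X c \<in> \<mu> \<and> rk (X c) = c"
    by (metis (no_types))
  let ?U = "\<Union>c\<in>rk ` \<mu>. X c"
  have U_small: "|?U| <o \<kappa>"
    using small_UNION[OF small_subset[OF R small_underS[OF a]], of X] X mem_small by blast
  have U: "?U \<subseteq> Field lam"
    using X mem_subset by blast
  obtain \<xi> where \<xi>: "\<xi> \<in> Field lam" "\<xi> \<notin> ?U"
    using lam_large small_subset[OF _ U_small, of "Field lam"] by blast
  have "|?U \<union> {\<xi>}| <o \<kappa>"
    using small_Un[OF U_small, of "{\<xi>}"] small_finite[of "{\<xi>}"] by simp
  then obtain Y where Y: "Y \<in> \<mu>" "?U \<union> {\<xi>} \<subseteq> Y"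
    using small_covered[of "?U \<union> {\<xi>}"] U \<xi>(1) by blast
  have "X (rk Y) \<subset> Y"
    using Y \<xi> by blast
  then have "rk (X (rk Y)) \<in> underS \<kappa> (rk Y)"
    using rk_less X Y(1) by blast
  then show False
    using X Y(1) by (simp add: underS_def)
qed

lemma superset_of_rank_ge:
  assumes "X \<in> \<mu>" "a \<in> Field \<kappa>"
  shows "\<exists>Y\<in>\<mu>. X \<subseteq> Y \<and> (a, rk Y) \<in> \<kappa>"
proof -
  obtain W where W: "W \<in> \<mu>" "(a, rk W) \<in> \<kappa>"
    using ranks_unbounded[OF assms(2)] by blast
  then obtain Y where "Y \<in> \<mu>" "X \<union> W \<subseteq> Y"
    using mem_directed assms(1) unfolding directed_def by blast
  then show ?thesis
    using W rk_mono[of Y W] transD[OF wo.TRANS W(2)] by blast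
qed

lemma superset_of_rank:
  assumes "X \<in> \<mu>" "(rk X, a) \<in> \<kappa>"
  shows "\<exists>Y\<in>\<mu>. X \<subseteq> Y \<and> rk Y = a"
proof -
  have "a \<in> Field \<kappa>"
    using assms(2) by (auto simp: Field_def)
  then show ?thesis
    using superset_of_rank_ge[OF assms(1)] interpolate[OF _ assms(1) _ assms(2)] by blast
qed

lemma covers_of_rank:
  assumes "\<xi> \<in> Field lam" "a \<in> Field \<kappa>"
  shows "\<exists>X\<in>\<mu>. \<xi> \<in> X \<and> rk X = a"
proof -
  obtain W where "W \<in> \<mu>" "\<xi> \<in> W"
    using small_covered[of "{\<xi>}"] assms(1) small_finite by blast
  then show ?thesis
    using superset_of_rank_ge[OF _ assms(2)] point_below[of _ \<xi> a] by blast
qed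

text \<open>Suppose \<open>a\<close> is below the rank of \<open>X\<close>. By coherence any
  \<open>Y\<close> of rank \<open>a\<close> containing a point \<xi> of \<open>X\<close> contains
  all of \<open>seg X \<xi>\<close>. For \<open>Z\<close> of rank \<open>a\<close> properly inside
  \<open>X\<close> and \<xi> in \<open>X\<close> outside \<open>Z\<close>, all of \<open>Z\<close>
  lies below \<xi>; so a \<open>Y\<close> of rank \<open>a\<close> through \<xi> properly contains
  \<open>Z\<close>, although the ranks are equal.\<close>

lemma rank_le_if_pairs_covered:
  assumes X: "X \<in> \<mu>" and a: "a \<in> Field \<kappa>"
    and pairs: "\<And>\<xi> \<eta>. \<xi> \<in> X \<Longrightarrow> \<eta> \<in> X \<Longrightarrow> \<exists>Y\<in>\<mu>. \<xi> \<in> Y \<and> \<eta> \<in> Y \<and> (rk Y, a) \<in> \<kappa>"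
  shows "(rk X, a) \<in> \<kappa>"
proof (rule ccontr)
  assume "\<not> ?thesis"
  then have less: "a \<in> underS \<kappa> (rk X)"
    using wo.not_underS_iff[OF a rk_Field[OF X]] by blast
  have seg_eq: "seg X \<xi> \<subseteq> Y" if Y: "Y \<in> \<mu>" "rk Y = a" "\<xi> \<in> X" "\<xi> \<in> Y" for Y \<xi>
  proof
    fix \<eta> assume \<eta>: "\<eta> \<in> seg X \<xi>"
    then obtain W where "W \<in> \<mu>" "\<xi> \<in> W" "\<eta> \<in> W" "(rk W, a) \<in> \<kappa>"
      using pairs Y(3) by blast
    then obtain Y' where "Y' \<in> \<mu>" "\<xi> \<in> Y'" "\<eta> \<in> Y'" "rk Y' = a"
      using superset_of_rank by blast
    moreover from this have "seg Y' \<xi> = seg Y \<xi>"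
      using coherent[of Y' Y \<xi>] Y by simp
    ultimately show "\<eta> \<in> Y"
      using \<eta> by blast
  qed
  obtain W where W: "W \<in> \<mu>" "W \<subset> X" "(a, rk W) \<in> \<kappa>"
    using rk_approx[OF X less] by blast
  obtain Z where Z: "Z \<in> \<mu>" "Z \<subset> X" "rk Z = a"
  proof (cases "X = {}")
    case True
    then show thesis using W(2) by blast
  next
    case False
    then obtain \<zeta> where \<zeta>: "\<zeta> \<in> X" by blast
    then obtain Z where "Z \<in> \<mu>" "Z \<subseteq> X" "rk Z = a"
      using point_below[OF X \<zeta>] less by (auto simp: underS_def)
    then show thesis
      using that less by (auto simp: underS_def)
  qed
  obtain \<xi> where \<xi>: "\<xi> \<in> X" "\<xi> \<notin> Z"
    using Z(2) by blast
  have above: "\<zeta> \<in> seg X \<xi>" if "\<zeta> \<in> Z" for \<zeta>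
  proof -
    have "\<xi> \<notin> underS lam \<zeta>" "\<xi> \<noteq> \<zeta>"
      using seg_eq[OF Z(1,3), of \<zeta>] that Z(2) \<xi> by auto
    then show ?thesis
      using lam.not_underS_iff[of \<xi> \<zeta>] that Z(2) \<xi>(1) mem_subset[OF X] by (auto simp: underS_def)
  qed
  obtain Y where Y: "Y \<in> \<mu>" "\<xi> \<in> Y" "rk Y = a"
    using covers_of_rank[of \<xi> a] mem_subset[OF X] \<xi>(1) a by blast
  have "Z \<subseteq> Y"
    using above seg_eq[OF Y(1,3) \<xi>(1) Y(2)] by blast
  then have "Z = Y"
    using rk_eq_subset Y Z by metis
  then show False
    using \<xi>(2) Y(2) by blast
qed

subsection \<open>Positions\<close>

text \<open>The choice is determined whenever a suitable \<open>X\<close> exists: by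
  \<open>coherent\<close> the segment does not depend on \<open>X\<close>, and its order type
  determines \<nu>.\<close>

definition pos :: "'k \<Rightarrow> 'o \<Rightarrow> 'k" where
  "pos a \<xi> = (SOME \<nu>. \<nu> \<in> Field \<kappa> \<and>
    (\<exists>X\<in>\<mu>. rk X = a \<and> \<xi> \<in> X \<and> Restr lam (seg X \<xi>) =o Restr \<kappa> (underS \<kappa> \<nu>)))"

lemma pos_eq:
  assumes X: "X \<in> \<mu>" "\<xi> \<in> X" "rk X = a"
  shows "pos a \<xi> \<in> Field \<kappa>" and "Restr lam (seg X \<xi>) =o Restr \<kappa> (underS \<kappa> (pos a \<xi>))"
proof -
  let ?r = "Restr lam (seg X \<xi>)"
  have wo: "Well_order ?r" and F: "Field ?r = seg X \<xi>"
    using Well_order_Restr[OF lam_well_order] Refl_Field_Restr2[OF lam.REFL, of "seg X \<xi>"] mem_subset[OF X(1)]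
    by auto
  have "|seg X \<xi>| <o \<kappa>"
    using small_subset[OF _ mem_small[OF X(1)]] by auto
  then have "?r <o \<kappa>"
    using F card_of_mono2[of \<kappa> ?r] card_of_Field_ordIso[OF card_order] wo well_order
    by (metis not_ordLeq_iff_ordLess not_ordLess_ordLeq ordIso_ordLeq_trans ordIso_symmetric)
  then obtain \<nu> where "\<nu> \<in> Field \<kappa>" "?r =o Restr \<kappa> (underS \<kappa> \<nu>)"
    using ordLess_iff_ordIso_Restr[OF well_order wo] by blast
  then have "\<exists>\<nu>. \<nu> \<in> Field \<kappa> \<and>
      (\<exists>X\<in>\<mu>. rk X = a \<and> \<xi> \<in> X \<and> Restr lam (seg X \<xi>) =o Restr \<kappa> (underS \<kappa> \<nu>))"
    using X by blast
  from someI_ex[OF this] obtain Y where "pos a \<xi> \<in> Field \<kappa>"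
    and Y: "Y \<in> \<mu>" "rk Y = a" "\<xi> \<in> Y" "Restr lam (seg Y \<xi>) =o Restr \<kappa> (underS \<kappa> (pos a \<xi>))"
    unfolding pos_def[symmetric] by blast
  moreover have "seg X \<xi> = seg Y \<xi>"
    using coherent[of X Y \<xi>] X Y by simp
  ultimately show "pos a \<xi> \<in> Field \<kappa>" "?r =o Restr \<kappa> (underS \<kappa> (pos a \<xi>))"
    by auto
qed

lemma pos_eq_iff:
  assumes X: "X \<in> \<mu>" "\<xi> \<in> X" "rk X = a" and Y: "Y \<in> \<mu>" "\<eta> \<in> Y" "rk Y = a"
  shows "pos a \<xi> = pos a \<eta> \<longleftrightarrow> Restr lam (seg X \<xi>) =o Restr lam (seg Y \<eta>)"
  using pos_eq[OF X] pos_eq[OF Y] underS_ordIso_iff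
  by (metis ordIso_symmetric ordIso_transitive)

lemma pos_inj:
  assumes "X \<in> \<mu>" "\<xi> \<in> X" "\<eta> \<in> X" "pos (rk X) \<xi> = pos (rk X) \<eta>"
  shows "\<xi> = \<eta>"
  using pos_eq_iff[of X \<xi> "rk X" X \<eta>] assms lam.Restr_underS_inj[OF mem_subset[OF assms(1)]] by simp

text \<open>The isomorphism carries the segment of \<open>Z\<close> at \<xi> onto the segment of the
  image at \<open>f \<xi>\<close>, and the image computes positions at the same level.\<close>

lemma pos_iso:
  assumes X: "X \<in> \<mu>" and Y: "Y \<in> \<mu>" and f: "iso (Restr lam X) (Restr lam Y) f"
    and Z: "Z \<in> \<mu>" "Z \<subseteq> X" "f ` Z \<in> \<mu>" "rk (f ` Z) = rk Z" "\<xi> \<in> Z"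
  shows "pos (rk Z) (f \<xi>) = pos (rk Z) \<xi>"
proof -
  have "Restr lam (seg Z \<xi>) =o Restr lam (seg (f ` Z) (f \<xi>))"
    using iso_Restr_underS[OF lam_well_order lam_well_order mem_subset[OF X] mem_subset[OF Y] f Z(2)] Z
    by blast
  then show ?thesis
    using pos_eq_iff[of Z \<xi> "rk Z" "f ` Z" "f \<xi>"] Z by auto
qed

text \<open>Equal positions at \<open>a\<close> force the isomorphism between two sets of rank
  \<open>a\<close> to send \<xi> to \<eta>. It then transports a set of rank \<open>c\<close>
  through \<xi> to one through \<eta>, preserving the position.\<close>

lemma pos_below:
  assumes "\<xi> \<in> Field lam" "\<eta> \<in> Field lam" "pos a \<xi> = pos a \<eta>" "(c, a) \<in> \<kappa>"
  shows "pos c \<xi> = pos c \<eta>"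
proof -
  have "a \<in> Field \<kappa>"
    using assms(4) by (auto simp: Field_def)
  then obtain X Y where X: "X \<in> \<mu>" "\<xi> \<in> X" "rk X = a" and Y: "Y \<in> \<mu>" "\<eta> \<in> Y" "rk Y = a"
    using covers_of_rank assms(1,2) by metis
  obtain f where f: "iso (Restr lam X) (Restr lam Y) f"
    and fm: "\<And>Z. Z \<in> \<mu> \<Longrightarrow> Z \<subseteq> X \<Longrightarrow> f ` Z \<in> \<mu> \<and> f ` Z \<subseteq> Y \<and> rk (f ` Z) = rk Z"
    using same_rank_iso[OF X(1) Y(1)] X Y by metis
  have "f \<xi> \<in> Y"
    using fm[OF X(1)] X(2) by blast
  moreover have "pos a (f \<xi>) = pos a \<xi>"
    using pos_iso[OF X(1) Y(1) f X(1)] fm[OF X(1)] X by simp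
  ultimately have f\<xi>: "f \<xi> = \<eta>"
    using pos_inj[OF Y(1), of "f \<xi>" \<eta>] Y assms(3) by simp
  obtain W where W: "W \<in> \<mu>" "\<xi> \<in> W" "W \<subseteq> X" "rk W = c"
    using point_below[OF X(1,2)] X(3) assms(4) by blast
  then show ?thesis
    using pos_iso[OF X(1) Y(1) f W(1,3) _ _ W(2)] fm[OF W(1,3)] f\<xi> by simp
qed

text \<open>A set of the same rank through \<xi> is mapped isomorphically onto \<open>X\<close>.
  This makes the levels small and lets information about points of \<open>X\<close> control every
  node of level \<open>rk X\<close>.\<close>

lemma pos_realized:
  assumes X: "X \<in> \<mu>" and \<xi>: "\<xi> \<in> Field lam"
  shows "\<exists>\<eta>\<in>X. pos (rk X) \<xi> = pos (rk X) \<eta>"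
proof -
  obtain Y where Y: "Y \<in> \<mu>" "\<xi> \<in> Y" "rk Y = rk X"
    using covers_of_rank[OF \<xi> rk_Field[OF X]] by blast
  obtain f where f: "iso (Restr lam Y) (Restr lam X) f"
    and fm: "\<And>Z. Z \<in> \<mu> \<Longrightarrow> Z \<subseteq> Y \<Longrightarrow> f ` Z \<in> \<mu> \<and> f ` Z \<subseteq> X \<and> rk (f ` Z) = rk Z"
    using same_rank_iso[OF Y(1) X Y(3)] by metis
  then have "pos (rk X) (f \<xi>) = pos (rk X) \<xi>" "f \<xi> \<in> X"
    using pos_iso[OF Y(1) X f Y(1)] fm[OF Y(1)] Y by auto
  then show ?thesis by metis
qed

text \<open>At the rank of a member containing both points, positions are injective on that
  member.\<close>

lemma pos_separates:
  assumes "\<xi> \<in> Field lam" "\<eta> \<in> Field lam" "\<xi> \<noteq> \<eta>"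
  shows "\<exists>a\<in>Field \<kappa>. pos a \<xi> \<noteq> pos a \<eta>"
proof -
  obtain Z where "Z \<in> \<mu>" "{\<xi>, \<eta>} \<subseteq> Z"
    using small_covered[of "{\<xi>, \<eta>}"] assms(1,2) small_finite[of "{\<xi>, \<eta>}"] by auto
  then show ?thesis
    using pos_inj[of Z \<xi> \<eta>] assms(3) rk_Field by blast
qed

subsection \<open>Reflection\<close>

text \<open>Closure under unions of chains of length \<open>< \<omega>\<close> is trivial, so that for \<open>\<kappa> = \<omega>\<close> a stationary
  \<open>\<mu>\<close> would contain all finite supersets \<open>Y\<close> of some \<open>X0\<close>. If \<open>Y\<close> has three elements outside of
  \<open>X0\<close>, then \<open>\<mu>|Y\<close> is neither directed nor generated by two of its elements.\<close>

lemma uncountable: "natLeq <o \<kappa>"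
proof (rule ccontr)
  assume "\<not> ?thesis"
  then have le: "\<kappa> \<le>o natLeq"
    by (metis not_ordLess_iff_ordLeq natLeq_Well_order well_order)
  have small_iff: "|A| <o \<kappa> \<longleftrightarrow> finite A" for A :: "'b set"
    using finite_iff_ordLess_natLeq ordLess_ordLeq_trans[OF _ le] small_finite by blast
  have "\<not> club_sets \<kappa> lam (small_sets \<kappa> lam - \<mu>)"
    using stationary unfolding stationary_sets_def by blast
  \<comment> \<open>A nonempty finite chain has a largest element, so the complement of \<mu> is
    closed under these unions. As it misses \<mu> it is no club, hence not cofinal, which yields
    \<open>X0\<close>.\<close>
  moreover have "\<Union>D \<in> small_sets \<kappa> lam - \<mu>"
    if D: "D \<subseteq> small_sets \<kappa> lam - \<mu>" "D \<noteq> {}" "chain\<^sub>\<subseteq> D" "|D| <o \<kappa>" for D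
  proof -
    obtain M where M: "M \<in> D" "\<And>A. A \<in> D \<Longrightarrow> M \<subseteq> A \<Longrightarrow> A = M"
      using finite_has_maximal[of D] D small_iff by metis
    then have "\<Union>D = M"
      using D(3) unfolding chain_subset_def by blast
    then show ?thesis
      using M(1) D(1) by blast
  qed
  ultimately obtain X0 where X0: "X0 \<in> small_sets \<kappa> lam"
    and all: "\<And>Y. Y \<in> small_sets \<kappa> lam \<Longrightarrow> X0 \<subseteq> Y \<Longrightarrow> Y \<in> \<mu>"
    unfolding club_sets_def by blast
  have fin: "finite X0" and X0_sub: "X0 \<subseteq> Field lam"
    using X0 small_iff by (auto simp: small_sets_def)
  have "infinite (Field lam - X0)"
    using fin lam_large small_iff[of "Field lam"] by simp
  then obtain E where E: "E \<subseteq> Field lam - X0" "card E = 3"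
    by (meson infinite_arbitrarily_large)
  then obtain a b c where abc: "E = {a, b, c}" "a \<noteq> b" "a \<noteq> c" "b \<noteq> c"
    by (auto simp: card_3_iff)
  let ?Y = "X0 \<union> {a, b, c}"
  let ?A = "X0 \<union> {a, b}" and ?B = "X0 \<union> {a, c}" and ?C = "X0 \<union> {b, c}"
  have mem: "?Y \<in> \<mu>" "?A \<in> \<mu>" "?B \<in> \<mu>" "?C \<in> \<mu>"
    using E(1) abc(1) fin X0_sub by (auto intro!: all simp: small_sets_def small_iff)
  have sub: "?A \<subset> ?Y" "?B \<subset> ?Y" "?C \<subset> ?Y"
    using E(1) abc by auto
  show False
    using mem(1)
  proof (cases rule: directed_or_star)
    case directed
    then show False
      using directed[OF mem(2,3) sub(1,2)] by blast
  next
    \<comment> \<open>Two of \<open>?A\<close>, \<open>?B\<close>, \<open>?C\<close> lie in the same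
      half, and the union of any two of them is \<open>?Y\<close>.\<close>
    case (star X1 X2)
    then show False
      using star(6)[OF mem(2) sub(1)] star(6)[OF mem(3) sub(2)] star(6)[OF mem(4) sub(3)] by blast
  qed
qed

text \<open>The sets closed under \<open>F\<close> form a club: \<omega> steps of closing off stay
  small because \<kappa> is regular and uncountable, and two points of the union of a chain lie in a
  single element of the chain.\<close>

lemma closed_member:
  assumes F: "\<And>\<xi> \<eta>. \<xi> \<in> Field lam \<Longrightarrow> \<eta> \<in> Field lam \<Longrightarrow> F \<xi> \<eta> \<subseteq> Field lam \<and> |F \<xi> \<eta>| <o \<kappa>"
  shows "\<exists>X\<in>\<mu>. \<forall>\<xi>\<in>X. \<forall>\<eta>\<in>X. F \<xi> \<eta> \<subseteq> X"
proof -
  let ?C = "{X \<in> small_sets \<kappa> lam. \<forall>\<xi>\<in>X. \<forall>\<eta>\<in>X. F \<xi> \<eta> \<subseteq> X}"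
  have "club_sets \<kappa> lam ?C"
    unfolding club_sets_def
  proof (intro conjI ballI allI impI)
    fix X0 assume X0: "X0 \<in> small_sets \<kappa> lam"
    define S where "S n = ((\<lambda>X. X \<union> (\<Union>\<xi>\<in>X. \<Union>\<eta>\<in>X. F \<xi> \<eta>)) ^^ n) X0" for n
    have S: "S 0 = X0" "\<And>n. S (Suc n) = S n \<union> (\<Union>\<xi>\<in>S n. \<Union>\<eta>\<in>S n. F \<xi> \<eta>)"
      by (simp_all add: S_def)
    have Sn: "S n \<subseteq> Field lam \<and> |S n| <o \<kappa>" for n
    proof (induction n)
      case 0
      then show ?case using X0 S(1) by (simp add: small_sets_def)
    next
      case (Suc n)
      then have "|\<Union>\<xi>\<in>S n. \<Union>\<eta>\<in>S n. F \<xi> \<eta>| <o \<kappa>"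
        using F by (intro small_UNION) blast+
      then show ?case
        unfolding S(2) using Suc F small_Un by blast
    qed
    have "|\<Union>n. S n| <o \<kappa>"
      using small_UNION[of UNIV S] Sn ordIso_ordLess_trans[OF card_of_nat uncountable] by blast
    moreover have "(\<Union>n. S n) \<subseteq> Field lam"
      using Sn by blast
    moreover have "F \<xi> \<eta> \<subseteq> (\<Union>n. S n)" if \<xi>\<eta>: "\<xi> \<in> (\<Union>n. S n)" "\<eta> \<in> (\<Union>n. S n)" for \<xi> \<eta>
    proof -
      have mono: "m \<le> n \<Longrightarrow> S m \<subseteq> S n" for m n
        using lift_Suc_mono_le[of S m n] S(2) by auto
      obtain m n where "\<xi> \<in> S m" "\<eta> \<in> S n"
        using \<xi>\<eta> by blast
      then have "\<xi> \<in> S (max m n)" "\<eta> \<in> S (max m n)"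
        using mono[of m "max m n"] mono[of n "max m n"] by auto
      then have "F \<xi> \<eta> \<subseteq> S (Suc (max m n))"
        unfolding S(2) by blast
      then show ?thesis by blast
    qed
    ultimately have "(\<Union>n. S n) \<in> ?C"
      by (auto simp: small_sets_def)
    moreover have "X0 \<subseteq> (\<Union>n. S n)"
      using S(1) by blast
    ultimately show "\<exists>Y\<in>?C. X0 \<subseteq> Y" by blast
  next
    fix D assume D: "D \<subseteq> ?C \<and> D \<noteq> {} \<and> chain\<^sub>\<subseteq> D \<and> |D| <o \<kappa>"
    then have "|\<Union>D| <o \<kappa>"
      using small_UNION[of D "\<lambda>Y. Y"] by (auto simp: small_sets_def)
    moreover have "F \<xi> \<eta> \<subseteq> \<Union>D" if \<xi>\<eta>: "\<xi> \<in> \<Union>D" "\<eta> \<in> \<Union>D" for \<xi> \<eta>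
    proof -
      obtain A B where "A \<in> D" "B \<in> D" "\<xi> \<in> A" "\<eta> \<in> B"
        using \<xi>\<eta> by blast
      moreover from this have "A \<subseteq> B \<or> B \<subseteq> A"
        using D by (simp add: chain_subset_def)
      ultimately obtain E where "E \<in> D" "\<xi> \<in> E" "\<eta> \<in> E"
        by blast
      moreover from this have "F \<xi> \<eta> \<subseteq> E"
        using D by blast
      ultimately show ?thesis
        by blast
    qed
    ultimately show "\<Union>D \<in> ?C"
      using D by (auto simp: small_sets_def)
  qed auto
  then obtain X where "X \<in> \<mu>" "X \<in> ?C"
    using stationary unfolding stationary_sets_def by blast
  then show ?thesis
    by blast
qed

text \<open>Let \<open>W \<xi> \<eta>\<close> be a member containing both points and
  \<open>V \<xi> \<eta>\<close> a member whose rank exceeds \<open>g \<xi>\<close> and all values of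
  \<open>h\<close> up to the rank of \<open>W \<xi> \<eta>\<close>. A member \<open>X\<close> closed
  under \<open>V\<close> works: \<open>rank_le_if_pairs_covered\<close> shows that the ranks of
  \<open>W\<close> on pairs from \<open>X\<close> reach every \<alpha> below the rank of
  \<open>X\<close>.\<close>

lemma reflection:
  assumes g: "\<And>\<xi>. \<xi> \<in> Field lam \<Longrightarrow> g \<xi> \<in> Field \<kappa>" and h: "\<And>\<alpha>. \<alpha> \<in> Field \<kappa> \<Longrightarrow> h \<alpha> \<in> Field \<kappa>"
  shows "\<exists>X\<in>\<mu>. (\<forall>\<xi>\<in>X. g \<xi> \<in> underS \<kappa> (rk X)) \<and> (\<forall>\<alpha>\<in>underS \<kappa> (rk X). h \<alpha> \<in> underS \<kappa> (rk X))"
proof -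
  have "\<exists>W\<in>\<mu>. \<xi> \<in> W \<and> \<eta> \<in> W" if "\<xi> \<in> Field lam" "\<eta> \<in> Field lam" for \<xi> \<eta>
    using small_covered[of "{\<xi>, \<eta>}"] that small_finite[of "{\<xi>, \<eta>}"] by auto
  then obtain W where W: "\<And>\<xi> \<eta>. \<xi> \<in> Field lam \<Longrightarrow> \<eta> \<in> Field lam \<Longrightarrow> W \<xi> \<eta> \<in> \<mu> \<and> \<xi> \<in> W \<xi> \<eta> \<and> \<eta> \<in> W \<xi> \<eta>"
    by metis
  have "\<exists>V\<in>\<mu>. g \<xi> \<in> underS \<kappa> (rk V) \<and> (\<forall>\<alpha>\<in>under \<kappa> (rk (W \<xi> \<eta>)). h \<alpha> \<in> underS \<kappa> (rk V))"
    if \<xi>\<eta>: "\<xi> \<in> Field lam" "\<eta> \<in> Field lam" for \<xi> \<eta>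
  proof -
    let ?B = "h ` under \<kappa> (rk (W \<xi> \<eta>)) \<union> {g \<xi>}"
    have "under \<kappa> (rk (W \<xi> \<eta>)) \<subseteq> Field \<kappa>"
      by (auto simp: under_def Field_def)
    then have "?B \<subseteq> Field \<kappa>"
      using g[OF \<xi>\<eta>(1)] h by blast
    moreover have "|?B| <o \<kappa>"
      using small_under[OF rk_Field] W[OF \<xi>\<eta>] small_image small_Un small_finite[of "{g \<xi>}"] by blast
    ultimately obtain b where b: "b \<in> Field \<kappa>" "\<And>a. a \<in> ?B \<Longrightarrow> a \<in> underS \<kappa> b"
      using small_bounded by blast
    obtain V where V: "V \<in> \<mu>" "(b, rk V) \<in> \<kappa>"
      using ranks_unbounded[OF b(1)] by blast
    have "\<forall>a\<in>?B. a \<in> underS \<kappa> (rk V)"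
      using b(2) wo.underS_trans[OF _ V(2)] by blast
    then show ?thesis
      using V(1) by auto
  qed
  then obtain V where V: "\<And>\<xi> \<eta>. \<xi> \<in> Field lam \<Longrightarrow> \<eta> \<in> Field lam \<Longrightarrow> V \<xi> \<eta> \<in> \<mu> \<and> g \<xi> \<in> underS \<kappa> (rk (V \<xi> \<eta>)) \<and>
      (\<forall>\<alpha>\<in>under \<kappa> (rk (W \<xi> \<eta>)). h \<alpha> \<in> underS \<kappa> (rk (V \<xi> \<eta>)))"
    by metis
  obtain X where X: "X \<in> \<mu>" "\<And>\<xi> \<eta>. \<xi> \<in> X \<Longrightarrow> \<eta> \<in> X \<Longrightarrow> V \<xi> \<eta> \<subseteq> X"
  proof -
    have "V \<xi> \<eta> \<subseteq> Field lam \<and> |V \<xi> \<eta>| <o \<kappa>" if "\<xi> \<in> Field lam" "\<eta> \<in> Field lam" for \<xi> \<eta>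
      using V[OF that] mem_subset mem_small by simp
    from closed_member[of V, OF this] show thesis
      using that by blast
  qed
  have le: "(rk (V \<xi> \<eta>), rk X) \<in> \<kappa>" if "\<xi> \<in> X" "\<eta> \<in> X" for \<xi> \<eta>
    using rk_mono[OF X(1) _ X(2)[OF that]] V[of \<xi> \<eta>] that mem_subset[OF X(1)] by blast
  have "g \<xi> \<in> underS \<kappa> (rk X)" if "\<xi> \<in> X" for \<xi>
    using V[of \<xi> \<xi>] wo.underS_trans[OF _ le[OF that that]] that mem_subset[OF X(1)] by blast
  moreover have "h \<alpha> \<in> underS \<kappa> (rk X)" if \<alpha>: "\<alpha> \<in> underS \<kappa> (rk X)" for \<alpha>
  proof -
    have \<alpha>F: "\<alpha> \<in> Field \<kappa>"
      using \<alpha> underS_subset by blast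
    have "(rk X, \<alpha>) \<notin> \<kappa>"
      using \<alpha> wo.not_underS_iff[OF \<alpha>F rk_Field[OF X(1)]] by blast
    \<comment> \<open>Some pair from \<open>X\<close> lies in no member of rank at most \<alpha>, so
      \<alpha> is among the arguments of \<open>h\<close> that \<open>V \<xi> \<eta>\<close> takes
      into account.\<close>
    then obtain \<xi> \<eta> where \<xi>\<eta>: "\<xi> \<in> X" "\<eta> \<in> X"
      and no: "\<And>Y. Y \<in> \<mu> \<Longrightarrow> \<xi> \<in> Y \<Longrightarrow> \<eta> \<in> Y \<Longrightarrow> (rk Y, \<alpha>) \<notin> \<kappa>"
      using rank_le_if_pairs_covered[OF X(1) \<alpha>F] by blast
    have F: "\<xi> \<in> Field lam" "\<eta> \<in> Field lam"
      using \<xi>\<eta> mem_subset[OF X(1)] by auto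
    have "(\<alpha>, rk (W \<xi> \<eta>)) \<in> \<kappa>"
      using no W[OF F] wo.TOTALS \<alpha>F rk_Field by blast
    then have "h \<alpha> \<in> underS \<kappa> (rk (V \<xi> \<eta>))"
      using V[OF F] by (simp add: under_def)
    then show ?thesis
      using wo.underS_trans[OF _ le[OF \<xi>\<eta>]] by blast
  qed
  ultimately show ?thesis
    using X(1) by blast
qed

end

text \<open>A node is a pair of a level and a position. Coding pairs by \<open>c\<close> keeps nodes
  of different levels apart and places the tree on the underlying type of \<kappa>.\<close>

lemma (in stationary_two_cardinal) branch_system_pos:
  assumes c: "inj_on c (Field \<kappa> \<times> Field \<kappa>)"
  shows "branch_system \<kappa> (Field lam) (\<lambda>a \<xi>. c (a, pos a \<xi>))"
proof -
  have pos_Field: "pos a \<xi> \<in> Field \<kappa>" if "a \<in> Field \<kappa>" "\<xi> \<in> Field lam" for a \<xi>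
    using covers_of_rank[OF that(2,1)] pos_eq(1) by blast
  have c_iff: "c (a, pos a \<xi>) = c (b, pos b \<eta>) \<longleftrightarrow> a = b \<and> pos a \<xi> = pos b \<eta>"
    if "a \<in> Field \<kappa>" "b \<in> Field \<kappa>" "\<xi> \<in> Field lam" "\<eta> \<in> Field lam" for a b \<xi> \<eta>
    using inj_on_eq_iff[OF c, of "(a, pos a \<xi>)" "(b, pos b \<eta>)"] pos_Field that by simp
  show ?thesis
  proof unfold_locales
    show "Field lam \<noteq> {}"
      using lam_large small_finite by force
  next
    fix \<alpha> \<beta> \<xi> \<eta> assume "\<alpha> \<in> Field \<kappa>" "\<beta> \<in> Field \<kappa>" "\<xi> \<in> Field lam" "\<eta> \<in> Field lam"
      "c (\<alpha>, pos \<alpha> \<xi>) = c (\<beta>, pos \<beta> \<eta>)"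
    then show "\<alpha> = \<beta>"
      using c_iff by blast
  next
    fix \<gamma> \<alpha> \<xi> \<eta> assume *: "(\<gamma>, \<alpha>) \<in> \<kappa>" "\<xi> \<in> Field lam" "\<eta> \<in> Field lam"
      "c (\<alpha>, pos \<alpha> \<xi>) = c (\<alpha>, pos \<alpha> \<eta>)"
    then have "pos \<alpha> \<xi> = pos \<alpha> \<eta>"
      using c_iff by (metis FieldI2)
    then show "c (\<gamma>, pos \<gamma> \<xi>) = c (\<gamma>, pos \<gamma> \<eta>)"
      using pos_below * by metis
  next
    fix \<alpha> assume "\<alpha> \<in> Field \<kappa>"
    then obtain X where X: "X \<in> \<mu>" "\<alpha> = rk X"
      using covers_of_rank lam_large small_finite by (metis all_not_in_conv finite.emptyI)
    then have "(\<lambda>\<xi>. c (\<alpha>, pos \<alpha> \<xi>)) ` Field lam \<subseteq> (\<lambda>\<xi>. c (\<alpha>, pos \<alpha> \<xi>)) ` X"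
      using pos_realized[OF X(1)] by fastforce
    then show "|(\<lambda>\<xi>. c (\<alpha>, pos \<alpha> \<xi>)) ` Field lam| <o \<kappa>"
      using small_subset small_image[OF mem_small[OF X(1)]] by blast
  next
    fix \<xi> \<eta> assume *: "\<xi> \<in> Field lam" "\<eta> \<in> Field lam" "\<xi> \<noteq> \<eta>"
    then show "\<exists>\<alpha>\<in>Field \<kappa>. c (\<alpha>, pos \<alpha> \<xi>) \<noteq> c (\<alpha>, pos \<alpha> \<eta>)"
      using pos_separates[OF *] c_iff by metis
  next
    fix g h assume "\<And>\<xi>. \<xi> \<in> Field lam \<Longrightarrow> g \<xi> \<in> Field \<kappa>" "\<And>\<alpha>. \<alpha> \<in> Field \<kappa> \<Longrightarrow> h \<alpha> \<in> Field \<kappa>"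
    \<comment> \<open>The level \<delta> is the rank of this \<open>X\<close>: each of its nodes is
      the position of a point of \<open>X\<close>, where \<open>g\<close> is below \<delta>.\<close>
    then obtain X where X: "X \<in> \<mu>" "\<forall>\<xi>\<in>X. g \<xi> \<in> underS \<kappa> (rk X)"
      "\<forall>\<alpha>\<in>underS \<kappa> (rk X). h \<alpha> \<in> underS \<kappa> (rk X)"
      using reflection[of g h] by blast
    have "\<exists>\<eta>\<in>Field lam. c (rk X, pos (rk X) \<xi>) = c (rk X, pos (rk X) \<eta>) \<and> g \<eta> \<in> underS \<kappa> (rk X)"
      if \<xi>: "\<xi> \<in> Field lam" for \<xi>
    proof -
      obtain \<eta> where "\<eta> \<in> X" "pos (rk X) \<xi> = pos (rk X) \<eta>"
        using pos_realized[OF X(1) \<xi>] by blast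
      then show ?thesis
        using X(2) mem_subset[OF X(1)] by auto
    qed
    then show "\<exists>\<delta>\<in>Field \<kappa>. (\<forall>\<alpha>\<in>underS \<kappa> \<delta>. h \<alpha> \<in> underS \<kappa> \<delta>) \<and>
        (\<forall>\<xi>\<in>Field lam. \<exists>\<eta>\<in>Field lam. c (\<delta>, pos \<delta> \<xi>) = c (\<delta>, pos \<delta> \<eta>) \<and> g \<eta> \<in> underS \<kappa> \<delta>)"
      using X(3) rk_Field[OF X(1)] by blast
  qed
qed

theorem theorem4p2:
  fixes \<kappa> :: "'k rel" and \<mu> :: "'k set set set"
  assumes "Cinfinite \<kappa>" and "regularCard \<kappa>"
    and "two_cardinal \<kappa> (cardSuc \<kappa>) \<mu>"
    and "stationary_sets \<kappa> (cardSuc \<kappa>) \<mu>"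
  shows "\<exists>T :: 'k rel. kurepa_tree \<kappa> T \<and> |branches \<kappa> T| =o cardSuc \<kappa> \<and>
           (\<forall>S \<subseteq> Field T. \<not> aronszajn_tree \<kappa> (Restr T S))"
proof -
  interpret regular_cardinal \<kappa>
    by unfold_locales (fact assms)+
  have suc: "Card_order (cardSuc \<kappa>)"
    using cardSuc_Card_order[OF card_order] .
  have F: "|Field (cardSuc \<kappa>)| =o cardSuc \<kappa>"
    using card_of_Field_ordIso[OF suc] .
  interpret stationary_two_cardinal \<kappa> "cardSuc \<kappa>" \<mu>
  proof unfold_locales
    show "Well_order (cardSuc \<kappa>)"
      using suc card_order_on_well_order_on by blast
    have "\<kappa> <o |Field (cardSuc \<kappa>)|"
      using ordLess_ordIso_trans[OF cardSuc_greater[OF card_order] ordIso_symmetric[OF F]] .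
    then show "\<not> |Field (cardSuc \<kappa>)| <o \<kappa>"
      using ordLess_transitive ordLess_irreflexive by blast
  qed (fact assms)+
  \<comment> \<open>An infinite cardinal equals its square, which provides the coding
    \<open>c\<close> of nodes.\<close>
  have "|Field \<kappa> \<times> Field \<kappa>| \<le>o |Field \<kappa>|"
    using card_of_Times_same_infinite[OF infinite_Field] ordIso_imp_ordLeq by blast
  then obtain c :: "'k \<times> 'k \<Rightarrow> 'k" where "inj_on c (Field \<kappa> \<times> Field \<kappa>)"
    unfolding card_of_ordLeq[symmetric] by blast
  then interpret branch_system \<kappa> "Field (cardSuc \<kappa>)" "\<lambda>a \<xi>. c (a, pos a \<xi>)"
    by (rule branch_system_pos)
  have card: "|branches \<kappa> tree| =o cardSuc \<kappa>"
    using ordIso_transitive[OF card_branches F] .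
  then have "kurepa_tree \<kappa> tree"
    unfolding kurepa_tree_def
    using tree_is_tree tree_has_height tree_small_levels ordIso_iff_ordLeq by blast
  then show ?thesis
    using card no_aronszajn_subtree by blast
qed

end
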